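(* Let $\varphi_1,\varphi_2$ be strongly convex functions and put $\Phi_i=\varphi_i\circ\log$, $i=1,2$. If $\varphi_2^{-1}-\varphi_1^{-1}$ is increasing, then $$\operatorname{Mult}(\mathcal H_{\Phi_1})\subset\operatorname{Mult}(\mathcal H_{\Phi_2}).$$
   Context: $\mathbb D$ is the open unit disk, $\mathbb T=\partial\mathbb D$ with normalized Lebesgue measure $m$, $\operatorname{Hol}(\mathbb D)$ is the space of holomorphic functions on $\mathbb D$, and $N^+$ is the Smirnov class on $\mathbb D$; functions in $N^+$ have non-tangential boundary values a.e. on $\mathbb T$, denoted by the same letter. A function $\varphi:\mathbb R\to[0,\infty)$ is strongly convex if it is convex, nondecreasing and $\lim_{t\to\infty}\varphi(t)/t=\infty$; one sets $\varphi(-\infty)=0$. With $\Phi=\varphi\circ\log$, the Hardy-Orlicz class is $\mathcal H_\Phi=\{f\in N^+:\int_{\mathbb T}\Phi(|f|)\,dm<\infty\}$. For $X\subset\operatorname{Hol}(\mathbb D)$, $\operatorname{Mult}(X)=\{g\in\operatorname{Hol}(\mathbb D): gf\in X \text{ for all } f\in X\}$. The inverse $\varphi_i^{-1}$ is defined on $(\inf\varphi_i,\infty)$ (a strongly convex function is strictly increasing on the set where it exceeds its infimum), and $\varphi_2^{-1}-\varphi_1^{-1}$ is considered on the common domain. Throughout, the paper supposes defining functions of Hardy-Orlicz classes to be sufficiently smooth. *)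

theory Defs
  imports "HOL-Analysis.Analysis"
begin

definition circle_measure :: "complex measure" where
  "circle_measure = distr (uniform_measure lborel {0..<2 * pi}) borel cis"

definition Hinf :: "(complex \<Rightarrow> complex) set" where
  "Hinf = {f. f holomorphic_on ball 0 1 \<and> bounded (f ` ball 0 1)}"

definition outer_function :: "(complex \<Rightarrow> complex) \<Rightarrow> bool" where
  "outer_function h \<longleftrightarrow>
     (\<exists>c \<psi>. norm c = 1 \<and> (\<forall>\<zeta>. 0 < \<psi> \<zeta>) \<and>
       integrable circle_measure (\<lambda>\<zeta>. ln (\<psi> \<zeta>)) \<and>
       (\<forall>z\<in>ball 0 1. h z =
          c * exp (LINT \<zeta>|circle_measure. (\<zeta> + z) / (\<zeta> - z) * of_real (ln (\<psi> \<zeta>)))))"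

text \<open>
  The Smirnov class, as the quotients of bounded holomorphic functions with outer denominator.
  Holomorphic functions on the disk are represented by total functions whose
  values outside the disk are irrelevant.
\<close>
definition smirnov :: "(complex \<Rightarrow> complex) set" where
  "smirnov = {f. \<exists>g\<in>Hinf. \<exists>h\<in>Hinf. outer_function h \<and> (\<forall>z\<in>ball 0 1. f z = g z / h z)}"

definition stolz_region :: "real \<Rightarrow> complex \<Rightarrow> complex set" where
  "stolz_region \<alpha> \<zeta> = {z \<in> ball 0 1. dist z \<zeta> < \<alpha> * (1 - norm z)}"

text \<open>
  Convergence along the supremum filter means convergence within every Stolz region at \<open>\<zeta>\<close>.
\<close>
definition nontangential :: "complex \<Rightarrow> complex filter" where
  "nontangential \<zeta> = (SUP \<alpha>\<in>{1<..}. at \<zeta> within stolz_region \<alpha> \<zeta>)"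

text \<open>
  Where the non-tangential limit does not exist, \<open>Lim\<close> returns an unspecified
  value; for functions in the Smirnov class this happens only on a null set.
\<close>
definition boundary_value :: "(complex \<Rightarrow> complex) \<Rightarrow> complex \<Rightarrow> complex" where
  "boundary_value f \<zeta> = Lim (nontangential \<zeta>) f"

definition strongly_convex :: "(real \<Rightarrow> real) \<Rightarrow> bool" where
  "strongly_convex \<phi> \<longleftrightarrow>
     (\<forall>t. 0 \<le> \<phi> t) \<and> convex_on UNIV \<phi> \<and> mono \<phi> \<and> filterlim (\<lambda>t. \<phi> t / t) at_top at_top"

text \<open>
  The composition of \<open>\<phi>\<close> with the logarithm on \<open>[0, \<infinity>)\<close>,
  with the convention \<open>\<phi> (-\<infinity>) = 0\<close>; negative arguments play no role.
\<close>
definition comp_log :: "(real \<Rightarrow> real) \<Rightarrow> real \<Rightarrow> real" where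
  "comp_log \<phi> x = (if x \<le> 0 then 0 else \<phi> (ln x))"

definition hardy_orlicz :: "(real \<Rightarrow> real) \<Rightarrow> (complex \<Rightarrow> complex) set" where
  "hardy_orlicz \<Phi> =
     {f \<in> smirnov. (\<integral>\<^sup>+ \<zeta>. ennreal (\<Phi> (norm (boundary_value f \<zeta>))) \<partial>circle_measure) < \<infinity>}"

definition Mult :: "(complex \<Rightarrow> complex) set \<Rightarrow> (complex \<Rightarrow> complex) set" where
  "Mult X = {g. g holomorphic_on ball 0 1 \<and> (\<forall>f\<in>X. (\<lambda>z. g z * f z) \<in> X)}"

definition inverse_dom :: "(real \<Rightarrow> real) \<Rightarrow> real set" where
  "inverse_dom \<phi> = {Inf (range \<phi>)<..}"

text \<open>
  The inverse of a strongly convex function, meaningful only on \<open>inverse_dom \<phi>\<close>;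
  the function is injective on the set where it exceeds its infimum.
\<close>
definition sc_inverse :: "(real \<Rightarrow> real) \<Rightarrow> real \<Rightarrow> real" where
  "sc_inverse \<phi> = inv_into {t. Inf (range \<phi>) < \<phi> t} \<phi>"

end

theory Submission
  imports Defs "HOL-Complex_Analysis.Complex_Analysis"
begin

text \<open>
  Let \<open>g\<close> multiply \<open>H\<^sub>1\<close> into itself and let \<open>f \<in> H\<^sub>2\<close>. Put \<open>\<sigma> = max s\<^sub>0 (\<phi>2 (log \<bar>f\<bar>))\<close> on the circle, with a
  constant \<open>s\<^sub>0\<close> large enough for \<open>\<Lambda> = \<phi>1\<^sup>-\<^sup>1(\<sigma>)\<close> to be defined and positive, and let \<open>F\<close> be the outer
  function with boundary modulus \<open>exp \<Lambda>\<close>. Since \<open>\<phi>1(\<Lambda>) = \<sigma>\<close> is integrable, \<open>F\<close> and hence \<open>g F\<close> lie in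
  \<open>H\<^sub>1\<close>. Where \<open>\<bar>g\<bar> \<ge> 1\<close>, the value \<open>s' = \<phi>1(log \<bar>g\<bar> + \<Lambda>)\<close> is at least \<open>\<sigma>\<close>, so monotonicity of
  \<open>\<phi>2\<^sup>-\<^sup>1 - \<phi>1\<^sup>-\<^sup>1\<close> gives \<open>\<phi>2\<^sup>-\<^sup>1(s') \<ge> \<phi>2\<^sup>-\<^sup>1(\<sigma>) + log \<bar>g\<bar> \<ge> log \<bar>f g\<bar>\<close>, that is
  \<open>\<phi>2(log \<bar>f g\<bar>) \<le> \<phi>1(log \<bar>g F\<bar>)\<close>; where \<open>\<bar>g\<bar> < 1\<close> trivially \<open>\<phi>2(log \<bar>f g\<bar>) \<le> \<phi>2(log \<bar>f\<bar>)\<close>.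

  The analytic input is Fatou's theorem on non-tangential limits. For Poisson integrals of
  integrable functions it holds at every Lebesgue point, and a bounded holomorphic function is
  the Poisson integral of the almost everywhere limit of suitable dilations, which are
  \<open>L\<^sup>2\<close>-Cauchy by Parseval's identity.
\<close>

section \<open>Arc length on the circle\<close>

lemma sets_circle_measure [simp, measurable_cong]: "sets circle_measure = sets borel"
  by (simp add: circle_measure_def)

lemma space_circle_measure [simp]: "space circle_measure = UNIV"
  by (simp add: circle_measure_def)

lemma cis_measurable [measurable]: "cis \<in> borel_measurable borel"
  by (intro borel_measurable_continuous_onI continuous_intros)

text \<open>In this form, integrals and almost everywhere statements pass to the line by the rules
  for densities and image measures.\<close>

lemma circle_measure_altdef:
  "circle_measure = distr (density lborel (\<lambda>t. ennreal (indicator {0..<2*pi} t / (2*pi)))) borel cis"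
proof -
  have "uniform_measure lborel {0..<2*pi} = density lborel (\<lambda>t. ennreal (indicator {0..<2*pi} t / (2*pi)))"
    unfolding uniform_measure_def
    by (intro arg_cong[where f="density lborel"] ext)
       (auto simp: indicator_def divide_ennreal[symmetric])
  then show ?thesis by (simp add: circle_measure_def)
qed

lemma emeasure_circle_measure_UNIV: "emeasure circle_measure UNIV = 1"
  unfolding circle_measure_def by (subst emeasure_distr) auto

interpretation circle: finite_measure circle_measure
  by (intro finite_measureI) (simp add: emeasure_circle_measure_UNIV)

lemma measure_circle_measure_UNIV [simp]: "measure circle_measure UNIV = 1"
  by (simp add: measure_def emeasure_circle_measure_UNIV)

lemma integrable_circle_measure_iff:
  fixes f :: "complex \<Rightarrow> 'a::{banach,second_countable_topology}"
  assumes [measurable]: "f \<in> borel_measurable borel"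
  shows "integrable circle_measure f \<longleftrightarrow> set_integrable lborel {0..<2*pi} (\<lambda>t. f (cis t))"
proof -
  let ?g = "\<lambda>t. indicator {0..<2*pi} t *\<^sub>R f (cis t)"
  have eq: "(\<lambda>t. (indicator {0..<2*pi} t / (2*pi)) *\<^sub>R f (cis t)) = (\<lambda>t. (1/(2*pi)) *\<^sub>R ?g t)"
    by (simp add: fun_eq_iff)
  have "integrable circle_measure f \<longleftrightarrow>
      integrable lborel (\<lambda>t. (indicator {0..<2*pi} t / (2*pi)) *\<^sub>R f (cis t))"
    unfolding circle_measure_altdef
    by (subst integrable_distr_eq, simp, simp, subst integrable_density) auto
  also have "\<dots> \<longleftrightarrow> set_integrable lborel {0..<2*pi} (\<lambda>t. f (cis t))"
    unfolding set_integrable_def eq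
    using integrable_scaleR_right[of "2*pi" lborel "\<lambda>t. (1/(2*pi)) *\<^sub>R ?g t"]
      integrable_scaleR_right[of "1/(2*pi)" lborel ?g] by auto
  finally show ?thesis .
qed

lemma integral_circle_measure:
  fixes f :: "complex \<Rightarrow> 'a::{banach,second_countable_topology}"
  assumes [measurable]: "f \<in> borel_measurable borel"
  shows "integral\<^sup>L circle_measure f = (LINT t:{0..<2*pi}|lborel. f (cis t)) /\<^sub>R (2*pi)"
proof -
  have "integral\<^sup>L circle_measure f =
      (\<integral>t. (indicator {0..<2*pi} t / (2*pi)) *\<^sub>R f (cis t) \<partial>lborel)"
    unfolding circle_measure_altdef
    by (subst integral_distr, simp, simp, subst integral_density) auto
  also have "\<dots> = (\<integral>t. (1/(2*pi)) *\<^sub>R (indicator {0..<2*pi} t *\<^sub>R f (cis t)) \<partial>lborel)"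
    by (simp add: field_simps)
  also have "\<dots> = (LINT t:{0..<2*pi}|lborel. f (cis t)) /\<^sub>R (2*pi)"
    unfolding set_lebesgue_integral_def by (subst integral_scaleR_right) (auto simp: field_simps)
  finally show ?thesis .
qed

text \<open>
  The Borel measurable function below inverts \<^const>\<open>cis\<close> on \<open>[0, 2\<pi>)\<close>, so the image of a
  Borel null set under \<^const>\<open>cis\<close> is a Borel null set.
\<close>
lemma AE_circle_measureI:
  assumes "AE t in lborel. t \<in> {0..<2*pi} \<longrightarrow> P (cis t)"
  shows "AE \<zeta> in circle_measure. P \<zeta>"
proof -
  \<comment> \<open>Away from 0, \<open>Ln\<close> has imaginary part in (-pi, pi]; shifting the
    negative values moves the branch to [0, 2 pi).\<close>
  define arg :: "complex \<Rightarrow> real" where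
    "arg z = (if Im (Ln z) < 0 then Im (Ln z) + 2*pi else Im (Ln z))" for z
  have arg_measurable [measurable]: "arg \<in> borel_measurable borel"
    unfolding arg_def by measurable
  have arg_cis: "arg (cis t) = t" if t: "t \<in> {0..<2*pi}" for t
  proof (cases "t \<le> pi")
    case True
    have "-pi < t"
      using t pi_gt_zero by (metis atLeastLessThan_iff less_le_trans neg_less_0_iff_less)
    then have "Ln (cis t) = \<i> * t"
      using True unfolding cis_conv_exp by (subst Ln_exp) auto
    then show ?thesis using t by (auto simp: arg_def)
  next
    case False
    \<comment> \<open>Beyond pi, \<open>Ln\<close> sees the representative t - 2 pi of the angle,
      which is negative and is shifted back by \<open>arg\<close>.\<close>
    have "cis t = cis (t - 2*pi)" by (simp add: cis_divide[symmetric])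
    also have "Ln \<dots> = \<i> * (t - 2*pi)"
      using False t unfolding cis_conv_exp by (subst Ln_exp) auto
    finally have "Ln (cis t) = \<i> * (t - 2*pi)" .
    then show ?thesis using t by (auto simp: arg_def)
  qed
  obtain N where N: "N \<in> null_sets lborel" "{t. \<not> (t \<in> {0..<2*pi} \<longrightarrow> P (cis t))} \<subseteq> N"
    using assms by (auto simp: eventually_ae_filter)
  then have [measurable]: "N \<in> sets borel" by auto
  \<comment> \<open>\<open>P\<close> need not be measurable, so the transfer along
    \<open>cis\<close> is made for a Borel condition that implies it.\<close>
  have "AE \<zeta> in circle_measure. arg \<zeta> \<notin> N \<and> \<zeta> = cis (arg \<zeta>)"
    unfolding circle_measure_altdef
  proof (subst AE_distr_iff)
    show "AE t in density lborel (\<lambda>t. ennreal (indicator {0..<2*pi} t / (2*pi))).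
        arg (cis t) \<notin> N \<and> cis t = cis (arg (cis t))"
      using AE_not_in[OF N(1)]
      by (subst AE_density) (auto simp: indicator_def arg_cis)
  qed auto
  moreover have "AE \<zeta> in circle_measure. arg \<zeta> \<in> {0..<2*pi}"
    unfolding circle_measure_altdef
    by (subst AE_distr_iff, simp, simp, subst AE_density) (auto simp: indicator_def arg_cis)
  ultimately show ?thesis
  proof eventually_elim
    case (elim \<zeta>)
    then show ?case using N(2) by (metis (mono_tags, lifting) mem_Collect_eq subset_iff)
  qed
qed

lemma AE_circle_measure_norm: "AE \<zeta> in circle_measure. norm \<zeta> = 1"
  by (intro AE_circle_measureI) auto

text \<open>The Lebesgue differentiation theorem is applied to cubes with lower corner
  \<open>x\<close>, which on the line are the intervals to the right of \<open>x\<close>. Left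
  averages are obtained later by reflection.\<close>

lemma right_averages_tendsto:
  fixes f :: "real \<Rightarrow> real"
  assumes f: "\<And>a b. set_integrable lborel {a..b} f"
  shows "AE x in lborel. \<forall>e>0. \<exists>d>0. \<forall>h. 0 < h \<and> h < d \<longrightarrow>
           \<bar>(LINT t:{x..x+h}|lborel. f t) / h - f x\<bar> < e"
proof -
  have i: "f integrable_on cbox a b" for a b
    using set_borel_integral_eq_integral(1)[OF f] by simp
  obtain N where N: "negligible N"
    "\<And>x e. \<lbrakk>x \<notin> N; 0 < e\<rbrakk> \<Longrightarrow> \<exists>d>0. \<forall>h. 0 < h \<and> h < d \<longrightarrow>
        norm(integral (cbox x (x + h *\<^sub>R One)) f /\<^sub>R h ^ DIM(real) - f x) < e"
    using integrable_ccontinuous_explicit[OF i] by metis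
  have "AE x in lebesgue. x \<notin> N"
    using N(1) by (simp add: negligible_iff_null_sets AE_not_in)
  then have "AE x in lborel. x \<notin> N"
    by (simp add: AE_completion_iff)
  then show ?thesis
  proof eventually_elim
    case (elim x)
    show ?case
    proof (intro allI impI)
      fix e :: real assume "e > 0"
      then obtain d where "d > 0" and d: "\<And>h. 0 < h \<Longrightarrow> h < d \<Longrightarrow> norm (integral {x..x+h} f /\<^sub>R h - f x) < e"
        using N(2)[OF elim, of e] by auto
      have "\<bar>(LINT t:{x..x+h}|lborel. f t) / h - f x\<bar> < e" if "0 < h" "h < d" for h
        using d[OF that] set_borel_integral_eq_integral(2)[OF f]
        by (simp add: divide_inverse mult.commute)
      then show "\<exists>d>0. \<forall>h. 0 < h \<and> h < d \<longrightarrow> \<bar>(LINT t:{x..x+h}|lborel. f t) / h - f x\<bar> < e"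
        using \<open>d > 0\<close> by blast
    qed
  qed
qed

section \<open>Lebesgue points\<close>

text \<open>The averages of \<open>norm (v t - q)\<close> are differentiated simultaneously for all
  q in a countable dense set; at a point \<open>x\<close> outside one null set, \<open>v x\<close>
  is then approximated by such a q.\<close>

lemma AE_lebesgue_point:
  fixes v :: "real \<Rightarrow> complex"
  assumes v: "integrable lborel v"
  shows "AE x in lborel. \<forall>e>0. \<exists>d>0. \<forall>h. 0 < h \<and> h < d \<longrightarrow>
           (LINT t:{x-h..x+h}|lborel. norm (v t - v x)) \<le> e * h"
proof -
  have int_gen: "set_integrable lborel {a..b} (\<lambda>t. norm (u t - q))"
    if u: "integrable lborel u" for a b q and u :: "real \<Rightarrow> complex"
  proof -
    have "set_integrable lborel {a..b} u"
      unfolding set_integrable_def using u by (intro integrable_mult_indicator) auto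
    then have "set_integrable lborel {a..b} (\<lambda>t. u t - q)"
      by (rule set_integral_diff) (auto intro: borel_integrable_atLeastAtMost')
    then show ?thesis by (rule set_integrable_norm)
  qed
  note int = int_gen[OF v]
  have "integrable lborel (\<lambda>t. v (-t))"
    using lborel_integrable_real_affine[OF v, of "-1" 0] by simp
  note int' = int_gen[OF this]
  obtain Q :: "complex set" where Q: "countable Q"
    and dense: "\<And>X. open X \<Longrightarrow> X \<noteq> {} \<Longrightarrow> \<exists>q\<in>Q. q \<in> X"
    using countable_dense_exists[where 'a=complex] by blast
  have R: "AE x in lborel. \<forall>q\<in>Q. \<forall>e>0. \<exists>d>0. \<forall>h. 0 < h \<and> h < d \<longrightarrow>
      \<bar>(LINT t:{x..x+h}|lborel. norm (v t - q)) / h - norm (v x - q)\<bar> < e"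
    using Q right_averages_tendsto[OF int] by (subst AE_ball_countable) auto
  define A where "A x \<longleftrightarrow> (\<forall>q\<in>Q. \<forall>e>0. \<exists>d>0. \<forall>h. 0 < h \<and> h < d \<longrightarrow>
      \<bar>(LINT t:{x..x+h}|lborel. norm (v (-t) - q)) / h - norm (v (-x) - q)\<bar> < e)" for x
  have "AE x in lborel. A x"
    unfolding A_def using Q right_averages_tendsto[OF int'] by (subst AE_ball_countable) auto
  \<comment> \<open>Lebesgue measure is invariant under \<open>uminus\<close>, so what holds at
    almost every point holds at the reflection of almost every point.\<close>
  then have "AE x in distr lborel borel uminus. A x"
    unfolding lborel_distr_uminus .
  then have "AE x in lborel. A (- x)"
    by (rule AE_distrD[rotated]) simp
  then have L: "AE x in lborel. \<forall>q\<in>Q. \<forall>e>0. \<exists>d>0. \<forall>h. 0 < h \<and> h < d \<longrightarrow>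
      \<bar>(LINT t:{-x..-x+h}|lborel. norm (v (-t) - q)) / h - norm (v x - q)\<bar> < e"
    unfolding A_def minus_minus .
  have reflect: "(LINT t:{-x..-x+h}|lborel. norm (v (-t) - q)) = (LINT t:{x-h..x}|lborel. norm (v t - q))"
    for x h q
    unfolding set_lebesgue_integral_def
    by (subst lborel_integral_real_affine[where c="-1" and t=0])
       (auto intro!: Bochner_Integration.integral_cong simp: indicator_def)
  show ?thesis
    using R L
  proof eventually_elim
    case (elim x)
    show ?case
    proof (intro allI impI)
      fix e :: real assume "e > 0"
      \<comment> \<open>Budget: each half of the interval contributes at most e/4 * h, and the
        constant e/8 over the length 2h contributes another e/4 * h.\<close>
      then have "e/8 > 0" by simp
      obtain q where q: "q \<in> Q" "q \<in> ball (v x) (e/8)"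
        using dense[of "ball (v x) (e/8)"] \<open>e > 0\<close> by auto
      have q': "norm (v x - q) < e/8" using q(2) by (simp add: dist_norm)
      obtain d1 where "d1 > 0" and d1: "\<And>h. 0 < h \<Longrightarrow> h < d1 \<Longrightarrow>
          \<bar>(LINT t:{x..x+h}|lborel. norm (v t - q)) / h - norm (v x - q)\<bar> < e/8"
        using elim(1)[rule_format, OF q(1) \<open>e/8 > 0\<close>] by blast
      obtain d2 where "d2 > 0" and d2: "\<And>h. 0 < h \<Longrightarrow> h < d2 \<Longrightarrow>
          \<bar>(LINT t:{-x..-x+h}|lborel. norm (v (-t) - q)) / h - norm (v x - q)\<bar> < e/8"
        using elim(2)[rule_format, OF q(1) \<open>e/8 > 0\<close>] by blast
      have "(LINT t:{x-h..x+h}|lborel. norm (v t - v x)) \<le> e * h"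
        if h: "0 < h" "h < min d1 d2" for h
      proof -
        have "(LINT t:{x..x+h}|lborel. norm (v t - q)) / h \<le> e/4"
          using d1[of h] h q' by linarith
        then have r: "(LINT t:{x..x+h}|lborel. norm (v t - q)) \<le> e/4 * h"
          using h by (simp add: divide_le_eq)
        have "(LINT t:{x-h..x}|lborel. norm (v t - q)) / h \<le> e/4"
          using d2[of h] h q' unfolding reflect by linarith
        then have l: "(LINT t:{x-h..x}|lborel. norm (v t - q)) \<le> e/4 * h"
          using h by (simp add: divide_le_eq)
        have "(LINT t:{x-h..x+h}|lborel. norm (v t - v x)) \<le>
            (LINT t:{x-h..x+h}|lborel. norm (v t - q) + e/8)"
        proof (intro set_integral_mono int set_integral_add)
          fix t
          show "norm (v t - v x) \<le> norm (v t - q) + e / 8"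
            using q' norm_triangle_ineq[of "v t - q" "q - v x"] by (simp add: norm_minus_commute)
        qed (auto intro: borel_integrable_atLeastAtMost')
        also have "\<dots> = (LINT t:{x-h..x+h}|lborel. norm (v t - q)) + (LINT t:{x-h..x+h}|lborel. e/8)"
          by (intro set_integral_add int) (auto intro: borel_integrable_atLeastAtMost')
        finally have 1: "(LINT t:{x-h..x+h}|lborel. norm (v t - v x)) \<le> \<dots>" .
        have 2: "(LINT t:{x-h..x+h}|lborel. e/8) = e/4 * h"
          using h by (simp add: set_lebesgue_integral_def)
        \<comment> \<open>The closed halves share the point \<open>x\<close>, so the two indicators
          together dominate the indicator of the whole interval.\<close>
        have 3: "(LINT t:{x-h..x+h}|lborel. norm (v t - q)) \<le>
            (LINT t:{x-h..x}|lborel. norm (v t - q)) + (LINT t:{x..x+h}|lborel. norm (v t - q))"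
        proof -
          have "(LINT t:{x-h..x+h}|lborel. norm (v t - q)) \<le>
            (\<integral>t. indicator {x-h..x} t *\<^sub>R norm (v t - q) + indicator {x..x+h} t *\<^sub>R norm (v t - q) \<partial>lborel)"
            unfolding set_lebesgue_integral_def
            using int[unfolded set_integrable_def]
            by (intro integral_mono Bochner_Integration.integrable_add) (auto simp: indicator_def)
          also have "\<dots> = (LINT t:{x-h..x}|lborel. norm (v t - q)) + (LINT t:{x..x+h}|lborel. norm (v t - q))"
            unfolding set_lebesgue_integral_def
            using int[unfolded set_integrable_def] by (intro Bochner_Integration.integral_add)
          finally show ?thesis .
        qed
        have "0 < e * h" using h \<open>e > 0\<close> by simp
        with 1 2 3 l r show ?thesis by linarith
      qed
      then show "\<exists>d>0. \<forall>h. 0 < h \<and> h < d \<longrightarrow>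
          (LINT t:{x-h..x+h}|lborel. norm (v t - v x)) \<le> e * h"
        using \<open>d1 > 0\<close> \<open>d2 > 0\<close> by (intro exI[of _ "min d1 d2"]) auto
    qed
  qed
qed

text \<open>The kernel is dominated by a sum over dyadic intervals around \<open>a\<close> of geometrically decaying heights.\<close>
lemma integral_kernel_le:
  fixes w k :: "real \<Rightarrow> real"
  assumes w: "set_integrable lborel {a-\<delta>..a+\<delta>} w" and w_nonneg: "\<And>t. 0 \<le> w t"
    and avg: "\<And>h. 0 < h \<Longrightarrow> h \<le> \<delta> \<Longrightarrow> (LINT t:{a-h..a+h}|lborel. w t) \<le> e * h"
    and k: "\<And>t. \<bar>t - a\<bar> \<le> \<delta> \<Longrightarrow> k t \<le> C * \<tau> / (max \<tau> \<bar>t - a\<bar>)\<^sup>2"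
    and kw: "set_integrable lborel {a-\<delta>..a+\<delta>} (\<lambda>t. k t * w t)"
    and pos: "0 < \<tau>" "0 < \<delta>" "0 \<le> C" "0 \<le> e"
  shows "(LINT t:{a-\<delta>..a+\<delta>}|lborel. k t * w t) \<le> 8 * C * e"
proof -
  \<comment> \<open>The radii \<open>2 ^ j * \<tau>\<close> with j up to \<open>K\<close> pass
    \<delta>, so finitely many dyadic intervals suffice.\<close>
  obtain K :: nat where K: "\<delta> / \<tau> < 2 ^ K"
    using real_arch_pow[of 2 "\<delta> / \<tau>"] by auto
  \<comment> \<open>Cutting the radius off at \<delta> keeps every interval within reach of
    \<open>avg\<close>. For j > 0, outside the preceding interval the distance from \<open>a\<close>
    exceeds \<open>2 ^ j * \<tau> / 2\<close>, which bounds the kernel by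
    \<open>c j\<close>.\<close>
  define h where "h j = min (2 ^ j * \<tau>) \<delta>" for j :: nat
  define c where "c j = 4 * C / (4 ^ j * \<tau>)" for j :: nat
  have h: "0 < h j" "h j \<le> \<delta>" "h j \<le> 2 ^ j * \<tau>" for j
    using pos by (auto simp: h_def)
  have c: "0 \<le> c j" for j
    using pos by (auto simp: c_def)
  have wi: "integrable lborel (\<lambda>t. indicator {a - h j..a + h j} t *\<^sub>R w t)" for j
  proof -
    have "set_integrable lborel {a - h j..a + h j} w"
      using w by (rule set_integrable_subset) (use h[of j] in auto)
    then show ?thesis by (simp add: set_integrable_def)
  qed
  have pointwise: "k t * w t \<le> (\<Sum>j\<le>K. c j * (indicator {a - h j..a + h j} t *\<^sub>R w t))"
    if t: "t \<in> {a-\<delta>..a+\<delta>}" for t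
  proof -
    define s where "s = \<bar>t - a\<bar>"
    have s: "s \<le> \<delta>" "s \<ge> 0" using t by (auto simp: s_def)
    have K': "s \<le> 2 ^ K * \<tau>"
      using K s pos by (simp add: divide_less_eq)
    \<comment> \<open>This is the first dyadic interval containing \<open>t\<close>; minimality
      supplies the lower bound on the distance from \<open>a\<close>.\<close>
    define j where "j = (LEAST j. s \<le> 2 ^ j * \<tau>)"
    have j: "s \<le> 2 ^ j * \<tau>" unfolding j_def by (rule LeastI[where P="\<lambda>j. s \<le> 2 ^ j * \<tau>", OF K'])
    have "j \<le> K" unfolding j_def by (rule Least_le[where P="\<lambda>j. s \<le> 2 ^ j * \<tau>", OF K'])
    have "k t \<le> C * \<tau> / (max \<tau> s)\<^sup>2"
      using k[of t] s by (simp add: s_def)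
    also have "\<dots> \<le> c j"
    proof (cases j)
      case 0
      have "C * \<tau> / (max \<tau> s)\<^sup>2 \<le> C * \<tau> / \<tau>\<^sup>2"
        using pos by (intro divide_left_mono mult_pos_pos power_mono) (auto simp: max_def)
      also have "\<dots> \<le> c j" using 0 pos by (simp add: c_def power2_eq_square field_simps)
      finally show ?thesis .
    next
      case (Suc i)
      have "\<not> s \<le> 2 ^ i * \<tau>"
        using not_less_Least[of i "\<lambda>j. s \<le> 2 ^ j * \<tau>"] Suc by (simp add: j_def)
      then have "2 ^ i * \<tau> \<le> max \<tau> s" by simp
      then have "C * \<tau> / (max \<tau> s)\<^sup>2 \<le> C * \<tau> / (2 ^ i * \<tau>)\<^sup>2"
        using pos by (intro divide_left_mono mult_pos_pos power_mono) auto
      also have "\<dots> = c j"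
        using Suc pos by (simp add: c_def power2_eq_square field_simps flip: power_mult_distrib)
      finally show ?thesis .
    qed
    finally have "k t * w t \<le> c j * (indicator {a - h j..a + h j} t *\<^sub>R w t)"
      using w_nonneg j s by (auto simp: h_def s_def abs_le_iff indicator_def intro!: mult_right_mono)
    also have "\<dots> \<le> (\<Sum>j\<le>K. c j * (indicator {a - h j..a + h j} t *\<^sub>R w t))"
      using \<open>j \<le> K\<close> c w_nonneg by (intro member_le_sum) (auto simp: indicator_def)
    finally show ?thesis .
  qed
  have "(LINT t:{a-\<delta>..a+\<delta>}|lborel. k t * w t) \<le>
      (\<integral>t. (\<Sum>j\<le>K. c j * (indicator {a - h j..a + h j} t *\<^sub>R w t)) \<partial>lborel)"
    unfolding set_lebesgue_integral_def
  proof (rule integral_mono)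
    show "integrable lborel (\<lambda>t. indicator {a-\<delta>..a+\<delta>} t *\<^sub>R (k t * w t))"
      using kw by (simp add: set_integrable_def)
    show "integrable lborel (\<lambda>t. \<Sum>j\<le>K. c j * (indicator {a - h j..a + h j} t *\<^sub>R w t))"
      using wi by (intro Bochner_Integration.integrable_sum integrable_mult_right)
    show "indicator {a-\<delta>..a+\<delta>} t *\<^sub>R (k t * w t)
        \<le> (\<Sum>j\<le>K. c j * (indicator {a - h j..a + h j} t *\<^sub>R w t))" for t
      using pointwise[of t] c w_nonneg by (auto simp: indicator_def intro!: sum_nonneg)
  qed
  also have "\<dots> = (\<Sum>j\<le>K. c j * (LINT t:{a - h j..a + h j}|lborel. w t))"
    unfolding set_lebesgue_integral_def
    using wi by (subst Bochner_Integration.integral_sum) auto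
  also have "\<dots> \<le> (\<Sum>j\<le>K. c j * (e * (2 ^ j * \<tau>)))"
  proof (intro sum_mono mult_left_mono c)
    fix j
    have "(LINT t:{a - h j..a + h j}|lborel. w t) \<le> e * h j" using avg h by simp
    also have "\<dots> \<le> e * (2 ^ j * \<tau>)" using h pos by (intro mult_left_mono) auto
    finally show "(LINT t:{a - h j..a + h j}|lborel. w t) \<le> e * (2 ^ j * \<tau>)" .
  qed
  \<comment> \<open>The heights decay like the powers of 1/4 and the lengths grow like the powers of
    2, which leaves a geometric series with sum below 2.\<close>
  also have "\<dots> = (\<Sum>j\<le>K. 4 * C * e * (1/2) ^ j)"
  proof (rule sum.cong[OF refl])
    fix j
    have "(4::real) ^ j = 2 ^ j * 2 ^ j" by (simp flip: power_mult_distrib)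
    then show "c j * (e * (2 ^ j * \<tau>)) = 4 * C * e * (1/2) ^ j"
      using pos by (simp add: c_def field_simps)
  qed
  also have "\<dots> = 4 * C * e * (\<Sum>j\<le>K. (1/2) ^ j)" by (simp add: sum_distrib_left)
  also have "\<dots> \<le> 4 * C * e * 2"
  proof (rule mult_left_mono)
    have "(\<Sum>j\<le>K. (1/2 :: real) ^ j) = 2 - (1/2) ^ K"
      by (induction K) auto
    then show "(\<Sum>j\<le>K. (1/2 :: real) ^ j) \<le> 2" by simp
    show "0 \<le> 4 * C * e" using pos by simp
  qed
  finally show ?thesis by simp
qed

section \<open>Poisson kernel\<close>

text \<open>This links contour integrals, which are gauge integrals over [0, 2 pi], to Lebesgue
  integrals against \<open>circle_measure\<close>. The cutoff by the indicator yields a Borel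
  function on the plane although \<open>g\<close> is controlled only on the circle.\<close>

lemma circle_integral_continuous:
  fixes g :: "complex \<Rightarrow> complex"
  assumes g: "continuous_on (sphere 0 1) g"
  shows "integrable circle_measure (\<lambda>\<zeta>. indicator (sphere 0 1) \<zeta> *\<^sub>R g \<zeta>)"
    and "((\<lambda>t. g (cis t)) has_integral
          (2*pi) *\<^sub>R (LINT \<zeta>|circle_measure. indicator (sphere 0 1) \<zeta> *\<^sub>R g \<zeta>)) {0..2*pi}"
proof -
  let ?h = "\<lambda>\<zeta>. indicator (sphere 0 1) \<zeta> *\<^sub>R g \<zeta>"
  have meas [measurable]: "?h \<in> borel_measurable borel"
    by (intro borel_measurable_continuous_on_indicator g) (simp add: borel_closed)
  have "bounded (g ` sphere 0 1)"
    by (intro compact_imp_bounded compact_continuous_image g) simp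
  then obtain B where B: "\<And>\<zeta>. \<zeta> \<in> sphere 0 1 \<Longrightarrow> norm (g \<zeta>) \<le> B"
    unfolding bounded_iff by blast
  have B0: "0 \<le> B" using B[of 1] by (smt (verit) dist_0_norm mem_sphere norm_ge_zero norm_one)
  show int: "integrable circle_measure ?h"
  proof (rule circle.integrable_const_bound[where B=B])
    show "AE \<zeta> in circle_measure. norm (?h \<zeta>) \<le> B"
      using B B0 by (auto simp: indicator_def)
  qed simp
  have c: "continuous_on {0..2*pi} (\<lambda>t. g (cis t))"
    by (intro continuous_on_compose2[OF g] continuous_intros) auto
  have "set_integrable lborel {0..<2*pi} (\<lambda>t. ?h (cis t))"
    using int integrable_circle_measure_iff[OF meas] by simp
  note * = set_borel_integral_eq_integral[OF this]
  have "(LINT \<zeta>|circle_measure. ?h \<zeta>) = (integral {0..<2*pi} (\<lambda>t. ?h (cis t))) /\<^sub>R (2*pi)"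
    unfolding integral_circle_measure[OF meas] *(2) ..
  also have "integral {0..<2*pi} (\<lambda>t. ?h (cis t)) = integral {0..<2*pi} (\<lambda>t. g (cis t))"
    by (simp add: indicator_def)
  also have "\<dots> = integral {0..2*pi} (\<lambda>t. g (cis t))"
  proof (rule integral_spike_set)
    show "negligible {x \<in> {0..<2*pi} - {0..2*pi}. g (cis x) \<noteq> 0}"
      by (rule negligible_subset[of "{}"]) auto
    show "negligible {x \<in> {0..2*pi} - {0..<2*pi}. g (cis x) \<noteq> 0}"
      by (rule negligible_subset[of "{2*pi}"]) auto
  qed
  finally have "(2*pi) *\<^sub>R (LINT \<zeta>|circle_measure. ?h \<zeta>) = integral {0..2*pi} (\<lambda>t. g (cis t))"
    by simp
  then show "((\<lambda>t. g (cis t)) has_integral (2*pi) *\<^sub>R (LINT \<zeta>|circle_measure. ?h \<zeta>)) {0..2*pi}"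
    using integrable_continuous_real[OF c] by (simp add: has_integral_integral)
qed

definition poisson_kernel :: "complex \<Rightarrow> complex \<Rightarrow> real" where
  "poisson_kernel z \<zeta> = (1 - (norm z)\<^sup>2) / (norm (\<zeta> - z))\<^sup>2"

lemma poisson_kernel_measurable [measurable]: "poisson_kernel z \<in> borel_measurable borel"
  unfolding poisson_kernel_def by measurable

lemma poisson_kernel_nonneg: "norm z < 1 \<Longrightarrow> 0 \<le> poisson_kernel z \<zeta>"
  by (simp add: poisson_kernel_def power_le_one)

lemma poisson_kernel_le_dist:
  assumes "norm z < 1" "0 < m" "m \<le> norm (\<zeta> - z)"
  shows "poisson_kernel z \<zeta> \<le> 2 * (1 - norm z) / m\<^sup>2"
proof -
  have "1 - (norm z)\<^sup>2 = (1 + norm z) * (1 - norm z)"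
    by (simp add: power2_eq_square algebra_simps)
  also have "\<dots> \<le> 2 * (1 - norm z)"
    using assms by (intro mult_right_mono) auto
  finally show ?thesis
    unfolding poisson_kernel_def using assms
    by (intro frac_le power_mono) (auto simp: power_le_one)
qed

lemma norm_diff_ge_circle:
  fixes z \<zeta> :: complex
  assumes "norm \<zeta> = 1"
  shows "1 - norm z \<le> norm (\<zeta> - z)"
  using norm_triangle_ineq2[of \<zeta> z] assms by simp

lemma poisson_kernel_le:
  assumes "norm z < 1" "norm \<zeta> = 1"
  shows "poisson_kernel z \<zeta> \<le> 2 / (1 - norm z)"
proof -
  have "poisson_kernel z \<zeta> \<le> 2 * (1 - norm z) / (1 - norm z)\<^sup>2"
    using assms norm_diff_ge_circle[of \<zeta> z] by (intro poisson_kernel_le_dist) auto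
  also have "\<dots> = 2 / (1 - norm z)"
    using assms by (simp add: power2_eq_square divide_divide_eq_left[symmetric] del: divide_divide_eq_left right_diff_distrib_numeral)
  finally show ?thesis .
qed

lemma integrable_poisson_kernel_scaleR:
  fixes u :: "complex \<Rightarrow> complex"
  assumes u: "integrable circle_measure u" and z: "norm z < 1"
  shows "integrable circle_measure (\<lambda>\<zeta>. poisson_kernel z \<zeta> *\<^sub>R u \<zeta>)"
proof (rule Bochner_Integration.integrable_bound)
  show "integrable circle_measure (\<lambda>\<zeta>. (2 / (1 - norm z)) *\<^sub>R u \<zeta>)"
    using u by simp
  show "(\<lambda>\<zeta>. poisson_kernel z \<zeta> *\<^sub>R u \<zeta>) \<in> borel_measurable circle_measure"
    using u by measurable
  show "AE \<zeta> in circle_measure. norm (poisson_kernel z \<zeta> *\<^sub>R u \<zeta>) \<le> norm ((2 / (1 - norm z)) *\<^sub>R u \<zeta>)"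
    using AE_circle_measure_norm
  proof eventually_elim
    case (elim \<zeta>)
    show ?case
      using mult_right_mono[OF poisson_kernel_le[OF z elim], of "norm (u \<zeta>)"]
        poisson_kernel_nonneg[OF z, of \<zeta>] z
      by simp
  qed
qed

text \<open>Cauchy's formula is applied not to \<open>f\<close> but to \<open>F\<close>, which
  agrees with \<open>f\<close> at \<open>z\<close>. On the circle 1 - \<open>cnj z\<close> w equals
  w \<open>cnj (w - z)\<close>, so the extra factor turns the Cauchy kernel into the Poisson
  kernel.\<close>

theorem poisson_formula:
  assumes cont: "continuous_on (cball 0 1) f" and holo: "f holomorphic_on ball 0 1"
    and z: "norm z < 1"
  shows "f z = (LINT \<zeta>|circle_measure. poisson_kernel z \<zeta> *\<^sub>R (indicator (sphere 0 1) \<zeta> *\<^sub>R f \<zeta>))"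
proof -
  let ?c = "of_real (1 - (norm z)\<^sup>2) :: complex"
  define F where "F w = f w * (?c / (1 - cnj z * w))" for w
  have nz: "1 - cnj z * w \<noteq> 0" if "norm w \<le> 1" for w
  proof
    assume "1 - cnj z * w = 0"
    then have "norm z * norm w = 1" by (metis complex_mod_cnj eq_iff_diff_eq_0 norm_mult norm_one)
    then show False using that z
      by (metis mult.right_neutral mult_left_mono norm_ge_zero not_le)
  qed
  have nz': "1 - cnj z * z = ?c"
    by (metis complex_norm_square mult.commute of_real_1 of_real_diff)
  have "((\<lambda>u. F u/(u-z)) has_contour_integral (2 * of_real pi * \<i> * F z)) (circlepath 0 1)"
    unfolding F_def using nz z
    by (intro Cauchy_integral_circlepath continuous_intros holomorphic_intros cont holo) auto
  then have "((\<lambda>t. F (cis t) / (cis t - z) * \<i> * cis t) has_integral (2 * of_real pi * \<i> * F z)) {0..2*pi}"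
    unfolding circlepath_def by (subst (asm) has_contour_integral_part_circlepath_iff) auto
  moreover have "F z = f z" using nz' nz[of z] z by (simp add: F_def)
  moreover have "F (cis t) / (cis t - z) * \<i> * cis t = \<i> * (poisson_kernel z (cis t) *\<^sub>R f (cis t))" for t
  proof -
    have d: "cis t - z \<noteq> 0" using z norm_cis[of t] by (metis eq_iff_diff_eq_0 less_irrefl)
    have "(1 - cnj z * cis t) = cis t * cnj (cis t - z)"
      using complex_norm_square[of "cis t"] by (simp add: algebra_simps)
    then have "F (cis t) / (cis t - z) * cis t = f (cis t) * ?c / ((cis t - z) * cnj (cis t - z))"
      by (simp add: F_def)
    also have "(cis t - z) * cnj (cis t - z) = of_real ((norm (cis t - z))\<^sup>2)"
      using complex_norm_square by simp
    finally have "F (cis t) / (cis t - z) * cis t = poisson_kernel z (cis t) *\<^sub>R f (cis t)"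
      by (simp add: poisson_kernel_def scaleR_conv_of_real mult_ac)
    then show ?thesis by (metis mult.assoc mult.commute)
  qed
  ultimately have 1: "((\<lambda>t. \<i> * (poisson_kernel z (cis t) *\<^sub>R f (cis t))) has_integral
      (2 * of_real pi * \<i> * f z)) {0..2*pi}" by simp
  have "continuous_on (sphere 0 1) (\<lambda>\<zeta>. poisson_kernel z \<zeta> *\<^sub>R f \<zeta>)"
    unfolding poisson_kernel_def using z
    by (intro continuous_intros continuous_on_subset[OF cont]) auto
  note has_integral_mult_right[OF circle_integral_continuous(2)[OF this], of \<i>]
  from has_integral_unique[OF this 1]
  have "2 * of_real pi * f z = 2 * of_real pi *
      (LINT \<zeta>|circle_measure. indicator (sphere 0 1) \<zeta> *\<^sub>R (poisson_kernel z \<zeta> *\<^sub>R f \<zeta>))"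
    by (simp add: scaleR_conv_of_real)
  then have "f z = (LINT \<zeta>|circle_measure. indicator (sphere 0 1) \<zeta> *\<^sub>R (poisson_kernel z \<zeta> *\<^sub>R f \<zeta>))"
    by simp
  then show ?thesis by (simp add: mult.commute)
qed

text \<open>The total mass is read off from the Poisson formula for the constant function 1.\<close>

lemma integral_poisson_kernel:
  assumes z: "norm z < 1"
  shows "integrable circle_measure (poisson_kernel z)" "integral\<^sup>L circle_measure (poisson_kernel z) = 1"
proof -
  have c: "integrable circle_measure (\<lambda>\<zeta>. poisson_kernel z \<zeta> *\<^sub>R (1::complex))"
    by (rule integrable_poisson_kernel_scaleR[OF _ z]) simp
  then have "integrable circle_measure (\<lambda>\<zeta>. Re (poisson_kernel z \<zeta> *\<^sub>R (1::complex)))"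
    by (rule integrable_Re)
  then show i: "integrable circle_measure (poisson_kernel z)" by simp
  have "1 = (LINT \<zeta>|circle_measure. poisson_kernel z \<zeta> *\<^sub>R (indicator (sphere 0 1) \<zeta> *\<^sub>R (1::complex)))"
    by (rule poisson_formula[OF _ _ z]) auto
  also have "\<dots> = (LINT \<zeta>|circle_measure. poisson_kernel z \<zeta> *\<^sub>R (1::complex))"
  proof (rule integral_cong_AE)
    show "AE \<zeta> in circle_measure. poisson_kernel z \<zeta> *\<^sub>R (indicator (sphere 0 1) \<zeta> *\<^sub>R (1::complex)) = poisson_kernel z \<zeta> *\<^sub>R (1::complex)"
      using AE_circle_measure_norm by eventually_elim simp
  qed (rule borel_measurable_integrable integrable_poisson_kernel_scaleR z
        circle_integral_continuous(1) c continuous_intros)+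
  also have "\<dots> = of_real (integral\<^sup>L circle_measure (poisson_kernel z))"
    by (simp add: scaleR_conv_of_real)
  finally show "integral\<^sup>L circle_measure (poisson_kernel z) = 1"
    by (metis of_real_eq_1_iff)
qed

text \<open>In the Stolz region, \<open>norm (z - \<zeta>)\<close> is below \<alpha> (1 -
  \<open>norm z\<close>), hence below \<alpha> \<open>norm (\<xi> - z)\<close>. Distances to
  \<open>z\<close> can therefore be replaced by distances to \<zeta> at the cost of a factor 1 +
  \<alpha>.\<close>

lemma poisson_kernel_le_stolz:
  assumes z: "z \<in> stolz_region \<alpha> \<zeta>" and \<xi>: "norm \<xi> = 1" and \<alpha>: "0 < \<alpha>"
  shows "poisson_kernel z \<xi> \<le> 2 * (1 + \<alpha>)\<^sup>2 * (1 - norm z) / (max (1 - norm z) (norm (\<xi> - \<zeta>)))\<^sup>2"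
proof -
  define m where "m = max (1 - norm z) (norm (\<xi> - \<zeta>)) / (1 + \<alpha>)"
  have z': "norm z < 1" "norm (z - \<zeta>) < \<alpha> * (1 - norm z)"
    using z by (auto simp: stolz_region_def dist_norm)
  have 1: "1 - norm z \<le> norm (\<xi> - z)" by (rule norm_diff_ge_circle[OF \<xi>])
  have "norm (\<xi> - \<zeta>) \<le> norm (\<xi> - z) + norm (z - \<zeta>)"
    using norm_triangle_ineq[of "\<xi> - z" "z - \<zeta>"] by simp
  also have "norm (z - \<zeta>) \<le> \<alpha> * norm (\<xi> - z)"
    using z'(2) mult_left_mono[OF 1, of \<alpha>] \<alpha> by linarith
  finally have 2: "norm (\<xi> - \<zeta>) \<le> (1 + \<alpha>) * norm (\<xi> - z)" by (simp add: algebra_simps)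
  have "1 - norm z \<le> (1 + \<alpha>) * norm (\<xi> - z)"
    using 1 mult_right_mono[of 1 "1 + \<alpha>" "norm (\<xi> - z)"] \<alpha> by simp
  with 2 have "m \<le> norm (\<xi> - z)"
    unfolding m_def using \<alpha> by (subst pos_divide_le_eq) (auto simp: mult.commute)
  moreover have "0 < m" unfolding m_def using z' \<alpha> by (intro divide_pos_pos) auto
  ultimately have "poisson_kernel z \<xi> \<le> 2 * (1 - norm z) / m\<^sup>2"
    using z' by (intro poisson_kernel_le_dist)
  also have "\<dots> = 2 * (1 + \<alpha>)\<^sup>2 * (1 - norm z) / (max (1 - norm z) (norm (\<xi> - \<zeta>)))\<^sup>2"
    using \<alpha> by (simp add: m_def power_divide field_simps)
  finally show ?thesis .
qed

section \<open>Boundary limits of Poisson integrals\<close>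

text \<open>The derivative of \<open>cis\<close> has modulus one, and close to \<open>a\<close> the
  error of the linear approximation takes away at most half of it.\<close>

lemma dist_cis_ge:
  obtains \<delta> where "\<delta> > 0" "\<And>t. \<bar>t - a\<bar> \<le> \<delta> \<Longrightarrow> \<bar>t - a\<bar> / 2 \<le> norm (cis t - cis a)"
proof -
  have "(cis has_derivative (\<lambda>h. h *\<^sub>R (\<i> * cis a))) (at a)"
    using has_derivative_cis[OF has_derivative_ident] .
  from this[unfolded has_derivative_at_alt, THEN conjunct2, rule_format, of "1/2"]
  obtain d where "d > 0" and d: "\<And>t. norm (t - a) < d \<Longrightarrow>
      norm (cis t - cis a - (t - a) *\<^sub>R (\<i> * cis a)) \<le> 1/2 * norm (t - a)"
    by auto
  show thesis
  proof (rule that[of "d/2"])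
    fix t assume t: "\<bar>t - a\<bar> \<le> d/2"
    have "norm ((t - a) *\<^sub>R (\<i> * cis a)) = \<bar>t - a\<bar>" by (simp add: norm_mult)
    moreover have "norm (cis t - cis a - (t - a) *\<^sub>R (\<i> * cis a)) \<le> 1/2 * \<bar>t - a\<bar>"
      using d[of t] t \<open>d > 0\<close> by simp
    moreover have "norm ((t - a) *\<^sub>R (\<i> * cis a)) - norm (cis t - cis a) \<le>
        norm (cis t - cis a - (t - a) *\<^sub>R (\<i> * cis a))"
      by (metis norm_minus_commute norm_triangle_ineq2)
    moreover have "A / 2 \<le> D" if "N = A" "B \<le> 1/2 * A" "N - D \<le> B" for A B D N :: real
      using that by linarith
    ultimately show "\<bar>t - a\<bar> / 2 \<le> norm (cis t - cis a)" by blast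
  qed (use \<open>d > 0\<close> in auto)
qed

text \<open>A positive continuous function attains a positive minimum on a compact set. Since
  \<open>a\<close> is interior, \<open>\<bar>t - a\<bar>\<close> stays below 2 pi even at the
  endpoints, so \<open>cis t = cis a\<close> would force t = a.\<close>

lemma dist_cis_ge_away:
  assumes a: "0 < a" "a < 2*pi" and \<delta>: "\<delta> > 0"
  obtains c where "c > 0" "\<And>t. t \<in> {0..2*pi} \<Longrightarrow> \<delta> \<le> \<bar>t - a\<bar> \<Longrightarrow> c \<le> norm (cis t - cis a)"
proof -
  define S where "S = {0..2*pi} - {a-\<delta><..<a+\<delta>}"
  have "compact S" unfolding S_def by (intro compact_diff) auto
  have "0 < norm (cis t - cis a)" if "t \<in> S" for t
  proof -
    have "cis t \<noteq> cis a"
    proof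
      assume "cis t = cis a"
      then have "cis (t - a) = 1" by (simp add: cis_divide[symmetric])
      then have "cos (t - a) = 1" by (metis cis.sel(1) one_complex.sel(1))
      then obtain n :: int where n: "t - a = of_int n * 2 * pi"
        using cos_one_2pi_int by blast
      have "\<bar>t - a\<bar> < 2 * pi" using that a by (auto simp: S_def)
      then have "\<bar>real_of_int n\<bar> < 1" unfolding n by (simp add: abs_mult)
      then have "n = 0" by linarith
      then show False using n that \<delta> by (auto simp: S_def)
    qed
    then show ?thesis by simp
  qed
  moreover have "continuous_on S (\<lambda>t. norm (cis t - cis a))"
    by (intro continuous_intros)
  ultimately obtain c where "c > 0" "\<And>t. t \<in> S \<Longrightarrow> c \<le> norm (cis t - cis a)"
  proof (cases "S = {}")
    case False
    then obtain t where t: "t \<in> S" "\<And>s. s \<in> S \<Longrightarrow> norm (cis t - cis a) \<le> norm (cis s - cis a)"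
      using continuous_attains_inf[OF \<open>compact S\<close> False \<open>continuous_on S _\<close>] by blast
    show thesis using that[of "norm (cis t - cis a)"] t \<open>\<And>t. t \<in> S \<Longrightarrow> 0 < _\<close> by blast
  qed (use that[of 1] in auto)
  moreover have "t \<in> S" if "t \<in> {0..2*pi}" "\<delta> \<le> \<bar>t - a\<bar>" for t
    using that by (auto simp: S_def abs_if split: if_splits)
  ultimately show thesis using that by blast
qed

text \<open>
  At a Lebesgue point \<open>cis a\<close>, the part of the Poisson integral near \<open>a\<close> is small because the
  kernel is dominated there by a multiple of \<open>\<tau> / (max \<tau> \<bar>t - a\<bar>)\<^sup>2\<close> with \<open>\<tau> = 1 - \<bar>z\<bar>\<close>, and the
  remaining part tends to zero since the kernel does so uniformly away from \<open>a\<close>.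
\<close>
theorem fatou_poisson:
  fixes u :: "complex \<Rightarrow> complex"
  assumes u: "integrable circle_measure u"
  shows "AE \<zeta> in circle_measure. \<forall>\<alpha>>1.
    ((\<lambda>z. LINT \<xi>|circle_measure. poisson_kernel z \<xi> *\<^sub>R u \<xi>) \<longlongrightarrow> u \<zeta>) (at \<zeta> within stolz_region \<alpha> \<zeta>)"
proof (rule AE_circle_measureI)
  define I where "I = {0..<2*pi}"
  define v where "v t = indicator I t *\<^sub>R u (cis t)" for t
  have u_meas [measurable]: "u \<in> borel_measurable borel"
    using u by (auto dest: borel_measurable_integrable)
  have v: "integrable lborel v"
    using u integrable_circle_measure_iff[OF u_meas]
    by (simp add: set_integrable_def v_def[abs_def] I_def)
  \<comment> \<open>Discarding the angle 0 leaves room on both sides of \<open>a\<close> inside [0,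
    2 pi), so no wrapping around the circle occurs.\<close>
  have "AE t in lborel. t \<noteq> 0"
    by (rule AE_lborel_singleton)
  with AE_lebesgue_point[OF v]
  show "AE a in lborel. a \<in> {0..<2*pi} \<longrightarrow> (\<forall>\<alpha>>1. ((\<lambda>z. LINT \<xi>|circle_measure. poisson_kernel z \<xi> *\<^sub>R u \<xi>) \<longlongrightarrow> u (cis a))
      (at (cis a) within stolz_region \<alpha> (cis a)))"
  proof eventually_elim
    case (elim a)
    show ?case
    proof (intro impI allI)
      fix \<alpha> :: real
      assume "a \<in> {0..<2*pi}" and \<alpha>: "1 < \<alpha>"
      with elim have a: "0 < a" "a < 2*pi" by auto
      have vI: "v t = u (cis t)" if "t \<in> I" for t using that by (simp add: v_def)
      have va: "v a = u (cis a)" using a by (intro vI) (auto simp: I_def)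
      define w where "w t = norm (v t - v a)" for t
      have v_meas [measurable]: "v \<in> borel_measurable borel"
        using v by (auto dest: borel_measurable_integrable)
      have w_meas [measurable]: "w \<in> borel_measurable borel"
        unfolding w_def by measurable
      have w_int: "set_integrable lborel A w" if "A \<in> sets borel" "A \<subseteq> {b..c}" for A and b c :: real
      proof (rule set_integrable_subset)
        have "set_integrable lborel {b..c} v"
          unfolding set_integrable_def using v by (intro integrable_mult_indicator) auto
        then have "set_integrable lborel {b..c} (\<lambda>t. v t - v a)"
          by (rule set_integral_diff) (auto intro: borel_integrable_atLeastAtMost')
        then show "set_integrable lborel {b..c} w"
          unfolding w_def by (rule set_integrable_norm)
      qed (use that in auto)
      have kw_int: "set_integrable lborel A (\<lambda>t. poisson_kernel z (cis t) * w t)"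
        if "norm z < 1" "A \<in> sets borel" "A \<subseteq> {b..c}" for z A and b c :: real
        unfolding set_integrable_def
      proof (rule Bochner_Integration.integrable_bound)
        show "integrable lborel (\<lambda>t. (2 / (1 - norm z)) *\<^sub>R (indicator A t *\<^sub>R w t))"
          using w_int[OF that(2,3)] unfolding set_integrable_def by (intro integrable_scaleR_right)
        show "(\<lambda>t. indicator A t *\<^sub>R (poisson_kernel z (cis t) * w t)) \<in> borel_measurable lborel"
          using that(2) by measurable
        have "poisson_kernel z (cis t) * w t \<le> 2 / (1 - norm z) * w t" for t
          using poisson_kernel_le[OF that(1)] by (intro mult_right_mono) (auto simp: w_def)
        then show "AE t in lborel. norm (indicator A t *\<^sub>R (poisson_kernel z (cis t) * w t))
            \<le> norm ((2 / (1 - norm z)) *\<^sub>R (indicator A t *\<^sub>R w t))"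
          using poisson_kernel_nonneg[OF that(1)] that(1)
          by (auto simp: indicator_def w_def)
      qed
      \<comment> \<open>As the kernel has total mass one, the error is the integral of the kernel
        against \<open>u \<xi> - u (cis a)\<close>.\<close>
      have diff: "norm ((LINT \<xi>|circle_measure. poisson_kernel z \<xi> *\<^sub>R u \<xi>) - u (cis a)) \<le>
          (LINT t:I|lborel. poisson_kernel z (cis t) * w t) / (2*pi)" if z: "norm z < 1" for z
      proof -
        have i: "integrable circle_measure (\<lambda>\<xi>. poisson_kernel z \<xi> *\<^sub>R u \<xi>)"
          "integrable circle_measure (\<lambda>\<xi>. poisson_kernel z \<xi> *\<^sub>R u (cis a))"
          by (intro integrable_poisson_kernel_scaleR u z; simp)+
        have "u (cis a) = (LINT \<xi>|circle_measure. poisson_kernel z \<xi> *\<^sub>R u (cis a))"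
          using integral_poisson_kernel[OF z] by simp
        then have "(LINT \<xi>|circle_measure. poisson_kernel z \<xi> *\<^sub>R u \<xi>) - u (cis a) =
            (LINT \<xi>|circle_measure. poisson_kernel z \<xi> *\<^sub>R u \<xi> - poisson_kernel z \<xi> *\<^sub>R u (cis a))"
          using i by (subst Bochner_Integration.integral_diff) auto
        also have "norm \<dots> \<le> (LINT \<xi>|circle_measure. norm (poisson_kernel z \<xi> *\<^sub>R u \<xi> - poisson_kernel z \<xi> *\<^sub>R u (cis a)))"
          by (rule integral_norm_bound)
        also have "\<dots> = (LINT t:I|lborel. norm (poisson_kernel z (cis t) *\<^sub>R u (cis t) - poisson_kernel z (cis t) *\<^sub>R u (cis a))) / (2*pi)"
          by (subst integral_circle_measure) (auto simp: I_def field_simps)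
        also have "(LINT t:I|lborel. norm (poisson_kernel z (cis t) *\<^sub>R u (cis t) - poisson_kernel z (cis t) *\<^sub>R u (cis a)))
            = (LINT t:I|lborel. poisson_kernel z (cis t) * w t)"
        proof (rule set_lebesgue_integral_cong)
          show "\<forall>t. t \<in> I \<longrightarrow> norm (poisson_kernel z (cis t) *\<^sub>R u (cis t) - poisson_kernel z (cis t) *\<^sub>R u (cis a))
              = poisson_kernel z (cis t) * w t"
            using poisson_kernel_nonneg[OF z]
            by (auto simp: w_def va vI simp flip: scaleR_diff_right)
        qed (auto simp: I_def)
        finally show ?thesis .
      qed
      show "((\<lambda>z. LINT \<xi>|circle_measure. poisson_kernel z \<xi> *\<^sub>R u \<xi>) \<longlongrightarrow> u (cis a)) (at (cis a) within stolz_region \<alpha> (cis a))"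
      proof (rule tendstoI)
        fix \<epsilon> :: real assume \<epsilon>: "\<epsilon> > 0"
        \<comment> \<open>The Stolz bound contributes 2 (1 + \<alpha>)\<open>\<^sup>2\<close>, and
          replacing the chord by half the angle contributes a factor 4. With the \<open>e\<close>
          chosen next, the bound \<open>8 * C * e\<close> of \<open>integral_kernel_le\<close>
          equals \<epsilon>.\<close>
        define C where "C = 8 * (1 + \<alpha>)\<^sup>2"
        have C: "C > 0" using \<alpha> by (simp add: C_def)
        define e where "e = \<epsilon> / (8 * C)"
        have e: "e > 0" using \<epsilon> C by (simp add: e_def)
        obtain d where "d > 0" and d: "\<And>h. 0 < h \<Longrightarrow> h < d \<Longrightarrow> (LINT t:{a-h..a+h}|lborel. w t) \<le> e * h"
          using elim(1)[rule_format, OF e] unfolding w_def by blast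
        obtain d' where "d' > 0" and d': "\<And>t. \<bar>t - a\<bar> \<le> d' \<Longrightarrow> \<bar>t - a\<bar> / 2 \<le> norm (cis t - cis a)"
          by (rule dist_cis_ge[of a]) blast
        \<comment> \<open>The entries serve in turn the averages (strictly below \<open>d\<close>),
          the comparison of chord and angle, and the inclusion of the interval around
          \<open>a\<close> in (0, 2 pi).\<close>
        define \<delta> where "\<delta> = Min {d/2, d', a/2, (2*pi-a)/2}"
        have \<delta>: "\<delta> > 0" "\<delta> < d" "\<delta> \<le> d'" "\<delta> < a" "\<delta> < 2*pi - a"
          using \<open>d > 0\<close> \<open>d' > 0\<close> a by (auto simp: \<delta>_def min_less_iff_disj min_le_iff_disj)
        obtain c where "c > 0" and c: "\<And>t. t \<in> {0..2*pi} \<Longrightarrow> \<delta> \<le> \<bar>t - a\<bar> \<Longrightarrow> c \<le> norm (cis t - cis a)"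
          using dist_cis_ge_away[OF a \<delta>(1)] by metis
        define W where "W = (LINT t:I|lborel. w t)"
        have W: "W \<ge> 0" unfolding W_def set_lebesgue_integral_def by (intro integral_nonneg_AE) (auto simp: w_def)
        have near: "(LINT t:{a-\<delta>..a+\<delta>}|lborel. poisson_kernel z (cis t) * w t) \<le> \<epsilon>"
          if z: "z \<in> stolz_region \<alpha> (cis a)" for z
        proof -
          have z1: "norm z < 1" using z by (auto simp: stolz_region_def)
          have "(LINT t:{a-\<delta>..a+\<delta>}|lborel. poisson_kernel z (cis t) * w t) \<le> 8 * C * e"
          proof (rule integral_kernel_le[where \<tau>="1 - norm z"])
            fix t assume t: "\<bar>t - a\<bar> \<le> \<delta>"
            have "poisson_kernel z (cis t) \<le> 2 * (1 + \<alpha>)\<^sup>2 * (1 - norm z) / (max (1 - norm z) (norm (cis t - cis a)))\<^sup>2"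
              using poisson_kernel_le_stolz[OF z] \<alpha> by simp
            also have "\<dots> \<le> 2 * (1 + \<alpha>)\<^sup>2 * (1 - norm z) / (max (1 - norm z) \<bar>t - a\<bar> / 2)\<^sup>2"
            proof (intro divide_left_mono power_mono mult_pos_pos)
              show "max (1 - norm z) \<bar>t - a\<bar> / 2 \<le> max (1 - norm z) (norm (cis t - cis a))"
                using d'[of t] t \<delta> z1 by (auto simp: max_def)
            qed (use z1 in auto)
            also have "\<dots> = C * (1 - norm z) / (max (1 - norm z) \<bar>t - a\<bar>)\<^sup>2"
              by (simp add: C_def power_divide)
            finally show "poisson_kernel z (cis t) \<le> C * (1 - norm z) / (max (1 - norm z) \<bar>t - a\<bar>)\<^sup>2" .
          next
            show "set_integrable lborel {a-\<delta>..a+\<delta>} w" by (rule w_int) auto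
            show "set_integrable lborel {a-\<delta>..a+\<delta>} (\<lambda>t. poisson_kernel z (cis t) * w t)"
              by (rule kw_int[OF z1]) auto
            show "0 \<le> w t" for t by (simp add: w_def)
          qed (use z1 \<delta> C e d in auto)
          then show ?thesis using C by (simp add: e_def)
        qed
        define M where "M = 2 * (1 + \<alpha>)\<^sup>2 / c\<^sup>2"
        have M: "M > 0" using \<open>c > 0\<close> \<alpha> by (simp add: M_def)
        have far: "(LINT t:I - {a-\<delta>..a+\<delta>}|lborel. poisson_kernel z (cis t) * w t) \<le> M * (1 - norm z) * W"
          if z: "z \<in> stolz_region \<alpha> (cis a)" for z
        proof -
          have z1: "norm z < 1" using z by (auto simp: stolz_region_def)
          have "(LINT t:I - {a-\<delta>..a+\<delta>}|lborel. poisson_kernel z (cis t) * w t) \<le>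
              (\<integral>t. M * (1 - norm z) * (indicator I t *\<^sub>R w t) \<partial>lborel)"
            unfolding set_lebesgue_integral_def
          proof (rule integral_mono)
            show "integrable lborel (\<lambda>t. indicator (I - {a-\<delta>..a+\<delta>}) t *\<^sub>R (poisson_kernel z (cis t) * w t))"
              unfolding set_integrable_def[symmetric]
              by (rule kw_int[OF z1, of _ 0 "2*pi"]) (auto simp: I_def)
            show "integrable lborel (\<lambda>t. M * (1 - norm z) * (indicator I t *\<^sub>R w t))"
              unfolding set_integrable_def[symmetric, of lborel I w]
              by (intro integrable_mult_right, unfold set_integrable_def[symmetric], rule w_int[of _ 0 "2*pi"])
                (auto simp: I_def)
            fix t
            have "poisson_kernel z (cis t) \<le> M * (1 - norm z)" if "t \<in> I - {a-\<delta>..a+\<delta>}"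
            proof -
              have "c \<le> norm (cis t - cis a)" using that by (intro c) (auto simp: I_def)
              then have "c\<^sup>2 \<le> (max (1 - norm z) (norm (cis t - cis a)))\<^sup>2"
                using \<open>c > 0\<close> by (intro power_mono) auto
              moreover have "poisson_kernel z (cis t) \<le> 2 * (1 + \<alpha>)\<^sup>2 * (1 - norm z) / (max (1 - norm z) (norm (cis t - cis a)))\<^sup>2"
                using poisson_kernel_le_stolz[OF z] \<alpha> by simp
              ultimately have "poisson_kernel z (cis t) \<le> 2 * (1 + \<alpha>)\<^sup>2 * (1 - norm z) / c\<^sup>2"
                using \<open>c > 0\<close> z1
                by (elim order.trans) (intro divide_left_mono mult_pos_pos, auto simp: max_def)
              then show ?thesis by (simp add: M_def)
            qed
            then show "indicator (I - {a-\<delta>..a+\<delta>}) t *\<^sub>R (poisson_kernel z (cis t) * w t)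
                \<le> M * (1 - norm z) * (indicator I t *\<^sub>R w t)"
              using M z1 by (auto simp: indicator_def w_def intro!: mult_right_mono)
          qed
          also have "\<dots> = M * (1 - norm z) * W"
            by (simp add: W_def set_lebesgue_integral_def)
          finally show ?thesis .
        qed
        \<comment> \<open>Within distance \<open>r\<close> the far part is at most \<epsilon> W / (W
          + 1); the added 1 covers the case W = 0.\<close>
        define r where "r = \<epsilon> / (M * (W + 1))"
        have r: "r > 0" using \<epsilon> M W by (simp add: r_def)
        have "eventually (\<lambda>z. dist z (cis a) < r \<and> z \<in> stolz_region \<alpha> (cis a)) (at (cis a) within stolz_region \<alpha> (cis a))"
          using r by (auto simp: eventually_at)
        then show "eventually (\<lambda>z. dist (LINT \<xi>|circle_measure. poisson_kernel z \<xi> *\<^sub>R u \<xi>) (u (cis a)) < \<epsilon>)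
            (at (cis a) within stolz_region \<alpha> (cis a))"
        proof eventually_elim
          case (elim z)
          then have z: "z \<in> stolz_region \<alpha> (cis a)" and zr: "norm (z - cis a) < r" by (auto simp: dist_norm)
          have z1: "norm z < 1" using z by (auto simp: stolz_region_def)
          have "1 - norm z \<le> norm (z - cis a)"
            using norm_diff_ge_circle[of "cis a" z] by (simp add: norm_minus_commute)
          then have "1 - norm z \<le> r" using zr by simp
          then have "M * (1 - norm z) * W \<le> M * r * W"
            using M W by (intro mult_right_mono mult_left_mono) auto
          also have "\<dots> = \<epsilon> * (W / (W + 1))" using M W by (simp add: r_def)
          also have "\<dots> \<le> \<epsilon> * 1" using \<epsilon> W by (intro mult_left_mono) auto
          finally have far': "M * (1 - norm z) * W \<le> \<epsilon>" by simp
          have "I = {a-\<delta>..a+\<delta>} \<union> (I - {a-\<delta>..a+\<delta>})" using \<delta> by (auto simp: I_def)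
          then have "(LINT t:I|lborel. poisson_kernel z (cis t) * w t) =
              (LINT t:{a-\<delta>..a+\<delta>} \<union> (I - {a-\<delta>..a+\<delta>})|lborel. poisson_kernel z (cis t) * w t)" by simp
          also have "\<dots> = (LINT t:{a-\<delta>..a+\<delta>}|lborel. poisson_kernel z (cis t) * w t)
              + (LINT t:I - {a-\<delta>..a+\<delta>}|lborel. poisson_kernel z (cis t) * w t)"
          proof (rule set_integral_Un)
            show "set_integrable lborel {a-\<delta>..a+\<delta>} (\<lambda>t. poisson_kernel z (cis t) * w t)"
              by (rule kw_int[OF z1]) auto
            show "set_integrable lborel (I - {a-\<delta>..a+\<delta>}) (\<lambda>t. poisson_kernel z (cis t) * w t)"
              by (rule kw_int[OF z1, of _ 0 "2*pi"]) (auto simp: I_def)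
          qed auto
          also have "\<dots> \<le> \<epsilon> + \<epsilon>"
            using near[OF z] far[OF z] far' by linarith
          \<comment> \<open>Near and far parts give \<epsilon> each, and the normalization by 2 pi
            brings their sum below \<epsilon>.\<close>
          finally have "(LINT t:I|lborel. poisson_kernel z (cis t) * w t) / (2*pi) \<le> (\<epsilon> + \<epsilon>) / (2*pi)"
            by (intro divide_right_mono) auto
          also have "\<dots> < \<epsilon>" using \<epsilon> pi_gt3 by (simp add: field_simps)
          finally show ?case
            using diff[OF z1] by (simp add: dist_norm)
        qed
      qed
    qed
  qed
qed

section \<open>Boundary limits of bounded holomorphic functions\<close>

text \<open>Integrating the series of the increments' norms termwise shows that it is finite almost
  everywhere; there the increments are absolutely summable and telescope.\<close>

lemma AE_convergent_if_summable_L1: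
  fixes x :: "nat \<Rightarrow> 'a \<Rightarrow> 'b::{banach, second_countable_topology}"
  assumes int: "\<And>k. integrable M (x k)"
    and sum: "summable (\<lambda>k. LINT \<omega>|M. norm (x (Suc k) \<omega> - x k \<omega>))"
  shows "AE \<omega> in M. convergent (\<lambda>k. x k \<omega>)"
proof -
  have [measurable]: "x k \<in> borel_measurable M" for k
    using int by (rule borel_measurable_integrable)
  have i: "integrable M (\<lambda>\<omega>. norm (x (Suc k) \<omega> - x k \<omega>))" for k
    using int by (intro integrable_norm Bochner_Integration.integrable_diff)
  have "(\<integral>\<^sup>+\<omega>. (\<Sum>k. ennreal (norm (x (Suc k) \<omega> - x k \<omega>))) \<partial>M) =
      (\<Sum>k. \<integral>\<^sup>+\<omega>. ennreal (norm (x (Suc k) \<omega> - x k \<omega>)) \<partial>M)"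
    by (rule nn_integral_suminf) measurable
  also have "\<dots> = (\<Sum>k. ennreal (LINT \<omega>|M. norm (x (Suc k) \<omega> - x k \<omega>)))"
    by (intro suminf_cong nn_integral_eq_integral i) auto
  also have "\<dots> = ennreal (\<Sum>k. LINT \<omega>|M. norm (x (Suc k) \<omega> - x k \<omega>))"
    by (intro suminf_ennreal2 sum) auto
  finally have "(\<integral>\<^sup>+\<omega>. (\<Sum>k. ennreal (norm (x (Suc k) \<omega> - x k \<omega>))) \<partial>M) \<noteq> \<infinity>"
    by simp
  then have "AE \<omega> in M. (\<Sum>k. ennreal (norm (x (Suc k) \<omega> - x k \<omega>))) \<noteq> \<infinity>"
    by (intro nn_integral_PInf_AE) auto
  then show ?thesis
  proof eventually_elim
    case (elim \<omega>)
    then have "summable (\<lambda>k. norm (x (Suc k) \<omega> - x k \<omega>))"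
      by (intro summable_suminf_not_top) auto
    then have "summable (\<lambda>k. x (Suc k) \<omega> - x k \<omega>)" by (rule summable_norm_cancel)
    then have "convergent (\<lambda>n. \<Sum>k<n. x (Suc k) \<omega> - x k \<omega>)"
      by (simp add: summable_iff_convergent)
    then have "convergent (\<lambda>n. x n \<omega> - x 0 \<omega>)" by (simp only: sum_lessThan_telescope[where f="\<lambda>k. x k \<omega>"])
    then have "convergent (\<lambda>n. (x n \<omega> - x 0 \<omega>) + x 0 \<omega>)"
      by (intro convergent_add convergent_const)
    then show ?case by simp
  qed
qed

text \<open>With \<open>b\<close> as majorant, the Weierstrass test makes the sum continuous in r on
  [0, 1], and at r = 1 every term vanishes.\<close>

lemma suminf_mult_one_minus_power_tendsto:
  fixes b :: "nat \<Rightarrow> real"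
  assumes b: "summable b" and nonneg: "\<And>n. 0 \<le> b n"
  shows "((\<lambda>r. \<Sum>n. b n * (1 - r ^ n)) \<longlongrightarrow> 0) (at_left 1)"
proof -
  define G where "G r = (\<Sum>n. b n * (1 - r ^ n))" for r :: real
  have "uniform_limit {0..1} (\<lambda>n r. \<Sum>k<n. b k * (1 - r ^ k)) G sequentially"
    unfolding G_def
  proof (rule Weierstrass_m_test)
    fix n and r :: real assume "r \<in> {0..1}"
    then have "0 \<le> 1 - r ^ n" "1 - r ^ n \<le> 1" by (auto simp: power_le_one)
    then show "norm (b n * (1 - r ^ n)) \<le> b n"
      using nonneg[of n] by (simp add: abs_mult mult_left_le)
  qed (rule b)
  then have "continuous_on {0..1} G"
    by (rule uniform_limit_theorem[rotated]) (auto intro!: always_eventually continuous_intros)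
  then have "(G \<longlongrightarrow> G 1) (at 1 within {0..1})"
    by (auto simp: continuous_on_def)
  then show ?thesis by (simp add: G_def[abs_def] at_within_Icc_at_left)
qed

section \<open>Dilations, Taylor coefficients and Parseval's identity\<close>

text \<open>The cutoff is there because for large \<zeta> the argument of \<open>f\<close> leaves
  the disk, where the values of \<open>f\<close> are arbitrary.\<close>

definition dilation  :: "(complex \<Rightarrow> complex) \<Rightarrow> real \<Rightarrow> complex \<Rightarrow> complex" where
  "dilation f r \<zeta> = indicator (sphere 0 1) \<zeta> *\<^sub>R f (of_real r * \<zeta>)"

definition taylor_coeff  :: "(complex \<Rightarrow> complex) \<Rightarrow> nat \<Rightarrow> complex" where
  "taylor_coeff f n = (deriv ^^ n) f 0 / fact n"

context
  fixes f :: "complex \<Rightarrow> complex"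
  assumes holo: "f holomorphic_on ball 0 1"
begin

lemma continuous_dilated:
  assumes "0 < r" "r < 1"
  shows "continuous_on (cball 0 1) (\<lambda>\<zeta>. f (of_real r * \<zeta>))"
proof (rule continuous_on_compose2[OF holomorphic_on_imp_continuous_on[OF holo]])
  have "r * norm x < 1" if "norm x \<le> 1" for x :: complex
    using mult_left_mono[OF that, of r] assms by linarith
  then show "(\<lambda>\<zeta>. complex_of_real r * \<zeta>) ` cball 0 1 \<subseteq> ball 0 1"
    using assms by (auto simp: norm_mult)
qed (intro continuous_intros)

lemma continuous_dilated_sphere:
  assumes "0 < r" "r < 1"
  shows "continuous_on (sphere 0 1) (\<lambda>\<zeta>. f (of_real r * \<zeta>))"
  using continuous_dilated[OF assms] by (rule continuous_on_subset) auto

lemma integrable_mult_dilation: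
  assumes "0 < r" "r < 1" and g: "continuous_on (sphere 0 1) g"
  shows "integrable circle_measure (\<lambda>\<zeta>. g \<zeta> * dilation f r \<zeta>)"
  using circle_integral_continuous(1)[OF continuous_on_mult[OF g continuous_dilated_sphere[OF assms(1,2)]]]
  by (simp add: dilation_def)

lemma dilation_measurable:
  assumes "0 < r" "r < 1"
  shows "dilation f r \<in> borel_measurable circle_measure"
  using integrable_mult_dilation[OF assms, of "\<lambda>_. 1"] by (simp add: borel_measurable_integrable)

lemma taylor_coeff_sums: "norm w < 1 \<Longrightarrow> (\<lambda>n. taylor_coeff f n * w ^ n) sums f w"
  using holomorphic_power_series[OF holo, of w] by (simp add: taylor_coeff_def)

text \<open>This is Cauchy's formula for the n-th derivative on the circle of radius
  \<open>s\<close>, where powers of \<open>cnj \<zeta>\<close> stand for negative powers of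
  \<zeta>.\<close>

lemma fourier_coeff_dilation:
  assumes s: "0 < s" "s < 1"
  shows "(LINT \<zeta>|circle_measure. cnj \<zeta> ^ n * dilation f s \<zeta>) = taylor_coeff f n * of_real s ^ n"
proof -
  let ?g = "\<lambda>\<zeta>. cnj \<zeta> ^ n * f (of_real s * \<zeta>)"
  have "((\<lambda>u. f u / (u-0) ^ (Suc n)) has_contour_integral ((2 * pi * \<i>) / (fact n) * (deriv ^^ n) f 0))
      (circlepath 0 s)"
    using s by (intro Cauchy_has_contour_integral_higher_derivative_circlepath
        holomorphic_on_imp_continuous_on holomorphic_on_subset[OF holo]) auto
  then have "((\<lambda>t. f (s * cis t) / (s * cis t) ^ (Suc n) * s * \<i> * cis t) has_integral
      (2 * pi * \<i>) * taylor_coeff f n) {0..2*pi}"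
    unfolding circlepath_def
    by (subst (asm) has_contour_integral_part_circlepath_iff) (auto simp: taylor_coeff_def)
  moreover have "f (s * cis t) / (s * cis t) ^ (Suc n) * s * \<i> * cis t = \<i> / of_real s ^ n * ?g (cis t)" for t
  proof -
    have "cnj (cis t) ^ n * cis t ^ n = 1"
      by (simp flip: power_mult_distrib add: cis_cnj cis_mult)
    then have "1 / cis t ^ n = cnj (cis t) ^ n"
      by (simp add: field_simps)
    then show ?thesis using s by (simp add: field_simps)
  qed
  ultimately have 1: "((\<lambda>t. \<i> / of_real s ^ n * ?g (cis t)) has_integral (2 * pi * \<i>) * taylor_coeff f n) {0..2*pi}"
    by simp
  have "continuous_on (sphere 0 1) ?g"
    by (intro continuous_intros continuous_dilated_sphere s)
  note has_integral_mult_right[OF circle_integral_continuous(2)[OF this], of "\<i> / of_real s ^ n"]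
  from has_integral_unique[OF this 1]
  have "2 * pi * \<i> * (LINT \<zeta>|circle_measure. indicator (sphere 0 1) \<zeta> *\<^sub>R ?g \<zeta>) =
      2 * pi * \<i> * (taylor_coeff f n * of_real s ^ n)"
    using s by (simp add: field_simps scaleR_conv_of_real)
  then show ?thesis by (simp add: dilation_def)
qed

text \<open>Only the first dilation is expanded into its Taylor series; integrating termwise leaves
  the Fourier coefficients of the second. Keeping two radii gives the mixed terms needed for
  differences of dilations.\<close>

lemma parseval_dilation:
  assumes r: "0 < r" "r < 1" and s: "0 < s" "s < 1"
  shows "(\<lambda>n. of_real ((norm (taylor_coeff f n))\<^sup>2 * (r * s) ^ n)) sums
           (LINT \<zeta>|circle_measure. dilation f r \<zeta> * cnj (dilation f s \<zeta>))"
proof -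
  define a where "a = taylor_coeff f"
  define F where "F n \<zeta> = a n * of_real r ^ n * (\<zeta> ^ n * cnj (dilation f s \<zeta>))" for n \<zeta>
  \<comment> \<open>Convergence of the power series at the larger radius \<open>q\<close> gives
    absolute convergence at \<open>r\<close>.\<close>
  obtain q where q: "r < q" "q < 1" using dense[OF r(2)] by blast
  have "summable (\<lambda>n. a n * of_real q ^ n)"
    using taylor_coeff_sums[of "of_real q"] q r by (auto simp: a_def sums_iff)
  then have sum: "summable (\<lambda>n. norm (a n * of_real r ^ n))"
    by (rule powser_insidea) (use q r in auto)
  have F_int: "integrable circle_measure (F n)" for n
  proof -
    have "integrable circle_measure (\<lambda>\<zeta>. cnj (cnj \<zeta> ^ n * dilation f s \<zeta>))"
      by (intro integrable_cnj integrable_mult_dilation s continuous_intros)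
    then show ?thesis unfolding F_def by simp
  qed
  have F_integral: "(LINT \<zeta>|circle_measure. F n \<zeta>) = of_real ((norm (a n))\<^sup>2 * (r * s) ^ n)" for n
  proof -
    have "(LINT \<zeta>|circle_measure. F n \<zeta>) =
        a n * of_real r ^ n * (LINT \<zeta>|circle_measure. cnj (cnj \<zeta> ^ n * dilation f s \<zeta>))"
      by (simp add: F_def)
    also have "(LINT \<zeta>|circle_measure. cnj (cnj \<zeta> ^ n * dilation f s \<zeta>)) = cnj (a n * of_real s ^ n)"
      unfolding a_def by (simp only: Bochner_Integration.integral_cnj fourier_coeff_dilation[OF s])
    also have "a n * of_real r ^ n * cnj (a n * of_real s ^ n) =
        (a n * cnj (a n)) * of_real ((r * s) ^ n)"
      by (simp add: power_mult_distrib)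
    also have "\<dots> = of_real ((norm (a n))\<^sup>2 * (r * s) ^ n)"
      by (simp only: of_real_mult complex_norm_square)
    finally show ?thesis .
  qed
  obtain B where B: "\<And>\<zeta>. norm (dilation f s \<zeta>) \<le> B"
  proof -
    have "bounded ((\<lambda>\<zeta>. f (of_real s * \<zeta>)) ` sphere 0 1)"
      by (intro compact_imp_bounded compact_continuous_image continuous_dilated_sphere s) simp
    then obtain B where "\<And>\<zeta>. \<zeta> \<in> sphere 0 1 \<Longrightarrow> norm (f (of_real s * \<zeta>)) \<le> B"
      unfolding bounded_iff by blast
    then have "norm (dilation f s \<zeta>) \<le> max B 0" for \<zeta>
      by (auto simp: dilation_def indicator_def le_max_iff_disj)
    then show thesis by (rule that)
  qed
  have F_bound: "norm (F n \<zeta>) \<le> norm (a n * of_real r ^ n) * B" if "norm \<zeta> = 1" for n \<zeta>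
    using B[of \<zeta>] that by (auto simp: F_def norm_mult norm_power intro!: mult_left_mono)
  have "(\<lambda>n. LINT \<zeta>|circle_measure. F n \<zeta>) sums (LINT \<zeta>|circle_measure. (\<Sum>n. F n \<zeta>))"
  proof (rule sums_integral)
    show "AE \<zeta> in circle_measure. summable (\<lambda>n. norm (F n \<zeta>))"
      using AE_circle_measure_norm
    proof eventually_elim
      case (elim \<zeta>)
      show ?case
        by (rule summable_comparison_test'[OF summable_mult2[OF sum]]) (use F_bound[OF elim] in auto)
    qed
    show "summable (\<lambda>n. LINT \<zeta>|circle_measure. norm (F n \<zeta>))"
    proof (rule summable_comparison_test'[OF summable_mult2[OF sum, of B]])
      fix n
      have "(LINT \<zeta>|circle_measure. norm (F n \<zeta>)) \<le> (LINT \<zeta>|circle_measure. norm (a n * of_real r ^ n) * B)"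
        using AE_circle_measure_norm
        by (intro integral_mono_AE integrable_norm F_int) (auto intro: F_bound)
      then show "norm (LINT \<zeta>|circle_measure. norm (F n \<zeta>)) \<le> norm (a n * of_real r ^ n) * B"
        by (simp add: integral_nonneg_AE)
    qed
  qed (rule F_int)
  also have "(LINT \<zeta>|circle_measure. (\<Sum>n. F n \<zeta>)) = (LINT \<zeta>|circle_measure. dilation f r \<zeta> * cnj (dilation f s \<zeta>))"
  proof (rule integral_cong_AE)
    show "AE \<zeta> in circle_measure. (\<Sum>n. F n \<zeta>) = dilation f r \<zeta> * cnj (dilation f s \<zeta>)"
      using AE_circle_measure_norm
    proof eventually_elim
      case (elim \<zeta>)
      have "(\<lambda>n. a n * (of_real r * \<zeta>) ^ n) sums f (of_real r * \<zeta>)"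
        unfolding a_def using elim r by (intro taylor_coeff_sums) (auto simp: norm_mult)
      then have "(\<lambda>n. a n * (of_real r * \<zeta>) ^ n * cnj (dilation f s \<zeta>)) sums (f (of_real r * \<zeta>) * cnj (dilation f s \<zeta>))"
        by (rule sums_mult2)
      then show ?case
        using elim by (auto simp: F_def sums_iff dilation_def power_mult_distrib mult_ac)
    qed
    have "F n \<in> borel_measurable circle_measure" for n
      using F_int by (rule borel_measurable_integrable)
    then show "(\<lambda>\<zeta>. \<Sum>n. F n \<zeta>) \<in> borel_measurable circle_measure" by measurable
    show "(\<lambda>\<zeta>. dilation f r \<zeta> * cnj (dilation f s \<zeta>)) \<in> borel_measurable circle_measure"
      by (intro borel_measurable_times dilation_measurable r s
          borel_measurable_continuous_on[where f=cnj] continuous_intros)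
  qed
  finally show ?thesis unfolding F_integral a_def .
qed

end

lemma norm_diff_power2:
  "(norm (x - y))\<^sup>2 = Re (x * cnj x) + Re (y * cnj y) - 2 * Re (x * cnj y)"
  by (simp add: cmod_power2) (simp add: power2_eq_square algebra_simps)

text \<open>The square is expanded by \<open>norm_diff_power2\<close> and Parseval's identity is
  applied to the pairs (r, r), (s, s) and (r, s).\<close>

lemma integral_dilation_diff:
  assumes holo: "f holomorphic_on ball 0 1"
    and r: "0 < r" "r < 1" and s: "0 < s" "s < 1"
  shows "(\<lambda>n. (norm (taylor_coeff f n))\<^sup>2 * (r ^ n - s ^ n)\<^sup>2) sums
           (LINT \<zeta>|circle_measure. (norm (dilation f r \<zeta> - dilation f s \<zeta>))\<^sup>2)"
    and "integrable circle_measure (\<lambda>\<zeta>. (norm (dilation f r \<zeta> - dilation f s \<zeta>))\<^sup>2)"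
proof -
  let ?b = "\<lambda>n. (norm (taylor_coeff f n))\<^sup>2"
  have cint: "integrable circle_measure (\<lambda>\<zeta>. dilation f r \<zeta> * cnj (dilation f s \<zeta>))"
    if "0 < r" "r < 1" "0 < s" "s < 1" for r s
  proof -
    have "continuous_on (sphere 0 1) (\<lambda>\<zeta>. f (of_real r * \<zeta>) * cnj (f (of_real s * \<zeta>)))"
      by (intro continuous_intros continuous_dilated_sphere[OF holo] that)
    from circle_integral_continuous(1)[OF this] show ?thesis
      by (rule back_subst[of "integrable circle_measure"])
        (auto simp: dilation_def indicator_def fun_eq_iff)
  qed
  then have int: "integrable circle_measure (\<lambda>\<zeta>. Re (dilation f r \<zeta> * cnj (dilation f s \<zeta>)))"
    if "0 < r" "r < 1" "0 < s" "s < 1" for r s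
    using that by (intro integrable_Re) auto
  have N: "(\<lambda>n. ?b n * (r * s) ^ n) sums (LINT \<zeta>|circle_measure. Re (dilation f r \<zeta> * cnj (dilation f s \<zeta>)))"
    if "0 < r" "r < 1" "0 < s" "s < 1" for r s
  proof -
    have "(\<lambda>n. ?b n * (r * s) ^ n) sums Re (LINT \<zeta>|circle_measure. dilation f r \<zeta> * cnj (dilation f s \<zeta>))"
      using sums_Re[OF parseval_dilation[OF holo that]] by (simp only: Re_complex_of_real)
    moreover have "Re (LINT \<zeta>|circle_measure. dilation f r \<zeta> * cnj (dilation f s \<zeta>)) =
        (LINT \<zeta>|circle_measure. Re (dilation f r \<zeta> * cnj (dilation f s \<zeta>)))"
      by (intro integral_Re[symmetric] cint that)
    ultimately show ?thesis by simp
  qed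
  show "integrable circle_measure (\<lambda>\<zeta>. (norm (dilation f r \<zeta> - dilation f s \<zeta>))\<^sup>2)"
    unfolding norm_diff_power2 using int r s
    by (intro Bochner_Integration.integrable_add Bochner_Integration.integrable_diff integrable_mult_right) auto
  have "(\<lambda>n. ?b n * (r * r) ^ n + ?b n * (s * s) ^ n - 2 * (?b n * (r * s) ^ n)) sums
     ((LINT \<zeta>|circle_measure. Re (dilation f r \<zeta> * cnj (dilation f r \<zeta>)))
      + (LINT \<zeta>|circle_measure. Re (dilation f s \<zeta> * cnj (dilation f s \<zeta>)))
      - 2 * (LINT \<zeta>|circle_measure. Re (dilation f r \<zeta> * cnj (dilation f s \<zeta>))))"
    by (intro sums_add sums_diff sums_mult N r s)
  also have "(\<lambda>n. ?b n * (r * r) ^ n + ?b n * (s * s) ^ n - 2 * (?b n * (r * s) ^ n)) = (\<lambda>n. ?b n * (r ^ n - s ^ n)\<^sup>2)"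
    by (simp add: power_mult_distrib power2_eq_square algebra_simps)
  also have "(LINT \<zeta>|circle_measure. Re (dilation f r \<zeta> * cnj (dilation f r \<zeta>)))
      + (LINT \<zeta>|circle_measure. Re (dilation f s \<zeta> * cnj (dilation f s \<zeta>)))
      - 2 * (LINT \<zeta>|circle_measure. Re (dilation f r \<zeta> * cnj (dilation f s \<zeta>))) =
      (LINT \<zeta>|circle_measure. (norm (dilation f r \<zeta> - dilation f s \<zeta>))\<^sup>2)"
    unfolding norm_diff_power2 using int r s
    by (subst Bochner_Integration.integral_diff, auto intro!: Bochner_Integration.integrable_add integrable_mult_right
        simp del: times_complex.sel complex_cnj)
  finally show "(\<lambda>n. ?b n * (r ^ n - s ^ n)\<^sup>2) sums
      (LINT \<zeta>|circle_measure. (norm (dilation f r \<zeta> - dilation f s \<zeta>))\<^sup>2)" .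
qed

text \<open>The boundary function is the almost everywhere limit of dilations along radii chosen to
  make the increments summable in L1. The Poisson formula holds for each dilation and survives the
  limit by dominated convergence.\<close>

theorem Hinf_poisson_integral:
  assumes f: "f \<in> Hinf"
  obtains u where "integrable circle_measure u"
    and "\<And>z. norm z < 1 \<Longrightarrow> f z = (LINT \<zeta>|circle_measure. poisson_kernel z \<zeta> *\<^sub>R u \<zeta>)"
proof -
  have holo: "f holomorphic_on ball 0 1" and "bounded (f ` ball 0 1)"
    using f by (auto simp: Hinf_def)
  then obtain B where "B > 0" and B: "\<And>z. norm z < 1 \<Longrightarrow> norm (f z) \<le> B"
    unfolding bounded_pos by auto
  have dil_bound: "norm (dilation f r \<zeta>) \<le> B" if "0 < r" "r < 1" for r \<zeta>
    using that \<open>B > 0\<close> by (auto simp: dilation_def indicator_def norm_mult intro!: B)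
  define b where "b n = (norm (taylor_coeff f n))\<^sup>2" for n
  have b: "0 \<le> b n" for n by (simp add: b_def)
  \<comment> \<open>By Parseval's identity with equal radii, the partial sums are bounded by the
    squared supremum of \<open>f\<close>; letting the radius tend to 1 then makes \<open>b\<close>
    summable.\<close>
  have partial: "(\<Sum>n<k. b n * (r * r) ^ n) \<le> B\<^sup>2" if r: "0 < r" "r < 1" for k r
  proof -
    have P: "(\<lambda>n. b n * (r * r) ^ n) sums Re (LINT \<zeta>|circle_measure. dilation f r \<zeta> * cnj (dilation f r \<zeta>))"
      using sums_Re[OF parseval_dilation[OF holo r r]] unfolding b_def by (simp only: Re_complex_of_real)
    have "(\<Sum>n<k. b n * (r * r) ^ n) \<le> Re (LINT \<zeta>|circle_measure. dilation f r \<zeta> * cnj (dilation f r \<zeta>))"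
      unfolding sums_unique[OF P] by (intro sum_le_suminf sums_summable[OF P]) (auto simp: b)
    also have "\<dots> \<le> norm (LINT \<zeta>|circle_measure. dilation f r \<zeta> * cnj (dilation f r \<zeta>))"
      by (rule complex_Re_le_cmod)
    also have "\<dots> \<le> (LINT \<zeta>|circle_measure. norm (dilation f r \<zeta> * cnj (dilation f r \<zeta>)))"
      by (rule integral_norm_bound)
    also have "\<dots> \<le> (LINT \<zeta>|circle_measure. B\<^sup>2)"
    proof (rule integral_mono')
      show "norm (dilation f r \<zeta> * cnj (dilation f r \<zeta>)) \<le> B\<^sup>2" for \<zeta>
        using dil_bound[OF r, of \<zeta>] by (auto simp: norm_mult simp flip: power2_eq_square intro!: power_mono)
    qed auto
    finally show ?thesis by simp
  qed
  have sum_b: "summable b"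
  proof (rule summableI_nonneg_bounded[OF b])
    fix k
    have "((\<lambda>r. \<Sum>n<k. b n * (r * r) ^ n) \<longlongrightarrow> (\<Sum>n<k. b n * (1 * 1) ^ n)) (at_left 1)"
      by (intro tendsto_intros)
    moreover have "eventually (\<lambda>r. 0 < r \<and> r < (1::real)) (at_left 1)"
      using eventually_at_left_real[of 0 "1::real"] by simp
    then have "eventually (\<lambda>r. (\<Sum>n<k. b n * (r * r) ^ n) \<le> B\<^sup>2) (at_left 1)"
      by eventually_elim (auto intro: partial)
    ultimately have "(\<Sum>n<k. b n * (1 * 1) ^ n) \<le> B\<^sup>2"
      by (rule tendsto_upperbound) simp
    then show "sum b {..<k} \<le> B\<^sup>2" by simp
  qed
  \<comment> \<open>For radii r, s in (0, 1), (r^n - s^n)\<open>\<^sup>2\<close> is at most (1 -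
    r^n) + (1 - s^n), so \<open>E r + E s\<close> bounds the squared L2 distance of the two
    dilations.\<close>
  define E where "E r = (\<Sum>n. b n * (1 - r ^ n))" for r :: real
  have "(E \<longlongrightarrow> 0) (at_left 1)"
    using suminf_mult_one_minus_power_tendsto[OF sum_b b] by (simp add: E_def[abs_def])
  \<comment> \<open>The lower bound drives the radii to 1; the bound on \<open>E\<close> makes the
    squared L2 norms of the increments of order 4^-k.\<close>
  have "\<exists>r. 0 < r \<and> r < 1 \<and> 1 - 1 / real (Suc k) < r \<and> E r < (1/4) ^ k" for k
  proof -
    have "eventually (\<lambda>r. E r < (1/4) ^ k) (at_left 1)"
      using \<open>(E \<longlongrightarrow> 0) (at_left 1)\<close> by (rule order_tendstoD) simp
    moreover have "eventually (\<lambda>r. r \<in> {max 0 (1 - 1 / real (Suc k))<..<1}) (at_left 1)"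
      by (rule eventually_at_left_real) auto
    ultimately have "eventually (\<lambda>r. 0 < r \<and> r < 1 \<and> 1 - 1 / real (Suc k) < r \<and> E r < (1/4) ^ k) (at_left 1)"
      by eventually_elim (unfold greaterThanLessThan_iff max_less_iff_conj, blast)
    then show ?thesis by (rule eventually_happens'[rotated]) simp
  qed
  then obtain r where r: "\<And>k. 0 < r k" "\<And>k. r k < 1" "\<And>k. 1 - 1 / real (Suc k) < r k"
      "\<And>k. E (r k) < (1/4) ^ k"
    by metis
  have r_lim: "r \<longlonglongrightarrow> 1"
  proof (rule tendsto_sandwich[of "\<lambda>k. 1 - 1 / real (Suc k)" _ _ "\<lambda>_. 1"])
    show "(\<lambda>k. 1 - 1 / real (Suc k)) \<longlonglongrightarrow> 1"
      using tendsto_diff[OF tendsto_const LIMSEQ_inverse_real_of_nat] by (simp add: divide_inverse)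
  qed (use r in \<open>auto intro!: always_eventually less_imp_le\<close>)
  define x where "x k = dilation f (r k)" for k
  have x_meas [measurable]: "x k \<in> borel_measurable circle_measure" for k
    unfolding x_def by (intro dilation_measurable holo r)
  have x_bound: "norm (x k \<zeta>) \<le> B" for k \<zeta>
    unfolding x_def by (intro dil_bound r)
  have x_int: "integrable circle_measure (x k)" for k
    by (rule circle.integrable_const_bound[where B=B]) (use x_bound in auto)
  have L1: "(LINT \<zeta>|circle_measure. norm (x (Suc k) \<zeta> - x k \<zeta>)) \<le> 3 * (1/2) ^ k" for k
  proof -
    note S = integral_dilation_diff[OF holo r(1,2)[of "Suc k"] r(1,2)[of k], folded x_def b_def]
    have sE: "(\<lambda>n. b n * (1 - r j ^ n)) sums E (r j)" for j
      unfolding E_def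
    proof (rule summable_sums, rule summable_comparison_test'[OF sum_b])
      fix n
      have "0 \<le> 1 - r j ^ n" "1 - r j ^ n \<le> 1" using r[of j] by (auto simp: power_le_one less_imp_le)
      then show "norm (b n * (1 - r j ^ n)) \<le> b n"
        using b[of n] by (simp add: abs_mult mult_left_le)
    qed
    have "(LINT \<zeta>|circle_measure. (norm (x (Suc k) \<zeta> - x k \<zeta>))\<^sup>2) \<le> E (r (Suc k)) + E (r k)"
    proof (rule sums_le[OF _ S(1) sums_add[OF sE sE]])
      fix n
      define p q where "p = r (Suc k) ^ n" and "q = r k ^ n"
      have pq: "0 \<le> p" "p \<le> 1" "0 \<le> q" "q \<le> 1"
        using r by (auto simp: p_def q_def power_le_one less_imp_le)
      have "(p - q)\<^sup>2 = \<bar>p - q\<bar> * \<bar>p - q\<bar>" by (simp add: power2_eq_square)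
      also have "\<dots> \<le> \<bar>p - q\<bar> * 1" using pq by (intro mult_left_mono) auto
      also have "\<dots> \<le> (1 - p) + (1 - q)" using pq by auto
      finally show "b n * (p - q)\<^sup>2 \<le> b n * (1 - p) + b n * (1 - q)"
        using b[of n] by (simp add: mult_left_mono flip: distrib_left)
    qed
    also have "\<dots> \<le> (1/4) ^ k + (1/4) ^ k"
    proof (rule add_mono)
      have "(1/4::real) ^ Suc k \<le> (1/4) ^ k" by simp
      then show "E (r (Suc k)) \<le> (1/4) ^ k" using r(4)[of "Suc k"] by linarith
    qed (use r(4)[of k] in simp)
    finally have L2: "(LINT \<zeta>|circle_measure. (norm (x (Suc k) \<zeta> - x k \<zeta>))\<^sup>2) \<le> 2 * (1/4) ^ k" by simp
    \<comment> \<open>A weighted inequality p \<le> 2^-k + 2^k p\<open>\<^sup>2\<close> replaces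
      Cauchy-Schwarz; the weight is balanced so that both terms become multiples of 2^-k.\<close>
    have "(LINT \<zeta>|circle_measure. norm (x (Suc k) \<zeta> - x k \<zeta>)) \<le>
        (LINT \<zeta>|circle_measure. (1/2) ^ k + 2 ^ k * (norm (x (Suc k) \<zeta> - x k \<zeta>))\<^sup>2)"
    proof (rule integral_mono)
      fix \<zeta>
      define p where "p = norm (x (Suc k) \<zeta> - x k \<zeta>)"
      have "0 \<le> (2 ^ k * p - 1)\<^sup>2 + 2 ^ k * p" by (simp add: p_def)
      then have "2 ^ k * p \<le> 1 + 2 ^ k * (2 ^ k * p\<^sup>2)"
        by (simp add: power2_eq_square algebra_simps)
      then show "p \<le> (1/2) ^ k + 2 ^ k * p\<^sup>2"
        by (simp add: field_simps)
    qed (use S(2) x_int in \<open>auto intro!: integrable_norm Bochner_Integration.integrable_diff\<close>)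
    also have "\<dots> = (1/2) ^ k + 2 ^ k * (LINT \<zeta>|circle_measure. (norm (x (Suc k) \<zeta> - x k \<zeta>))\<^sup>2)"
      using S(2) by (subst Bochner_Integration.integral_add) auto
    also have "\<dots> \<le> (1/2) ^ k + 2 ^ k * (2 * (1/4) ^ k)"
      by (intro add_left_mono mult_left_mono L2) simp
    also have "2 ^ k * (2 * (1/4) ^ k) = 2 * (1/2 :: real) ^ k"
      by (simp flip: power_mult_distrib)
    finally show ?thesis by simp
  qed
  have "summable (\<lambda>k. LINT \<zeta>|circle_measure. norm (x (Suc k) \<zeta> - x k \<zeta>))"
    by (rule summable_comparison_test'[of "\<lambda>k. 3 * (1/2) ^ k"])
      (use L1 in \<open>auto simp: integral_nonneg_AE intro!: summable_mult summable_geometric\<close>)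
  then have conv: "AE \<zeta> in circle_measure. convergent (\<lambda>k. x k \<zeta>)"
    using x_int by (intro AE_convergent_if_summable_L1)
  define u where "u \<zeta> = lim (\<lambda>k. x k \<zeta>)" for \<zeta>
  have u_meas [measurable]: "u \<in> borel_measurable circle_measure"
    unfolding u_def by measurable
  have lim: "AE \<zeta> in circle_measure. (\<lambda>k. x k \<zeta>) \<longlonglongrightarrow> u \<zeta>"
    using conv by eventually_elim (simp add: u_def convergent_LIMSEQ_iff)
  then have "AE \<zeta> in circle_measure. norm (u \<zeta>) \<le> B"
    by eventually_elim (rule tendsto_upperbound[OF tendsto_norm], auto simp: x_bound)
  then have u_int: "integrable circle_measure u"
    by (intro circle.integrable_const_bound[where B=B]) auto
  moreover have "f z = (LINT \<zeta>|circle_measure. poisson_kernel z \<zeta> *\<^sub>R u \<zeta>)" if z: "norm z < 1" for z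
  proof (rule LIMSEQ_unique)
    have "(LINT \<zeta>|circle_measure. poisson_kernel z \<zeta> *\<^sub>R x k \<zeta>) = f (of_real (r k) * z)" for k
    proof -
      have "r k * norm w < 1" if "norm w < 1" for w :: complex
        using mult_strict_mono[of "r k" 1 "norm w" 1] that r[of k] by (auto simp: mult_less_cancel_right2)
      then have "(\<lambda>w. f (of_real (r k) * w)) holomorphic_on ball 0 1"
        using r[of k]
        by (intro holomorphic_on_compose_gen[OF _ holo, unfolded o_def] holomorphic_intros)
          (auto simp: norm_mult)
      from poisson_formula[OF continuous_dilated[OF holo r(1,2)] this z]
      show ?thesis by (simp add: x_def dilation_def)
    qed
    moreover have "(\<lambda>k. LINT \<zeta>|circle_measure. poisson_kernel z \<zeta> *\<^sub>R x k \<zeta>) \<longlonglongrightarrow>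
        (LINT \<zeta>|circle_measure. poisson_kernel z \<zeta> *\<^sub>R u \<zeta>)"
    proof (rule integral_dominated_convergence)
      show "integrable circle_measure (\<lambda>\<zeta>. poisson_kernel z \<zeta> * B)"
        using integral_poisson_kernel(1)[OF z] by simp
      show "AE \<zeta> in circle_measure. (\<lambda>k. poisson_kernel z \<zeta> *\<^sub>R x k \<zeta>) \<longlonglongrightarrow> poisson_kernel z \<zeta> *\<^sub>R u \<zeta>"
        using lim by eventually_elim (intro tendsto_intros)
      show "AE \<zeta> in circle_measure. norm (poisson_kernel z \<zeta> *\<^sub>R x k \<zeta>) \<le> poisson_kernel z \<zeta> * B" for k
        using poisson_kernel_nonneg[OF z] x_bound by (auto intro!: mult_left_mono)
    qed measurable
    ultimately show "(\<lambda>k. f (of_real (r k) * z)) \<longlonglongrightarrow> (LINT \<zeta>|circle_measure. poisson_kernel z \<zeta> *\<^sub>R u \<zeta>)"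
      by simp
    have "isCont f (of_real 1 * z)"
      using holomorphic_on_imp_continuous_on[OF holo] z
      by (simp add: continuous_on_eq_continuous_at)
    then have "(\<lambda>k. f (of_real (r k) * z)) \<longlonglongrightarrow> f (of_real 1 * z)"
      by (rule isCont_tendsto_compose) (intro tendsto_intros r_lim)
    then show "(\<lambda>k. f (of_real (r k) * z)) \<longlonglongrightarrow> f z" by simp
  qed
  ultimately show thesis by (rule that)
qed

text \<open>The function representing \<open>f\<close> as a Poisson integral supplies the limit,
  with one exceptional null set for all apertures.\<close>

theorem fatou_Hinf:
  assumes f: "f \<in> Hinf"
  shows "AE \<zeta> in circle_measure. \<exists>l. \<forall>\<alpha>>1. (f \<longlongrightarrow> l) (at \<zeta> within stolz_region \<alpha> \<zeta>)"
proof -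
  obtain u where u: "integrable circle_measure u"
    and eq: "\<And>z. norm z < 1 \<Longrightarrow> f z = (LINT \<zeta>|circle_measure. poisson_kernel z \<zeta> *\<^sub>R u \<zeta>)"
    using Hinf_poisson_integral[OF f] by blast
  show ?thesis
    using fatou_poisson[OF u]
  proof eventually_elim
    case (elim \<zeta>)
    have "(f \<longlongrightarrow> u \<zeta>) (at \<zeta> within stolz_region \<alpha> \<zeta>)" if "\<alpha> > 1" for \<alpha>
    proof (rule Lim_transform_eventually)
      show "((\<lambda>z. LINT \<xi>|circle_measure. poisson_kernel z \<xi> *\<^sub>R u \<xi>) \<longlongrightarrow> u \<zeta>) (at \<zeta> within stolz_region \<alpha> \<zeta>)"
        using elim that by blast
      show "eventually (\<lambda>z. (LINT \<xi>|circle_measure. poisson_kernel z \<xi> *\<^sub>R u \<xi>) = f z) (at \<zeta> within stolz_region \<alpha> \<zeta>)"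
        by (auto simp: eventually_at_filter stolz_region_def eq intro!: always_eventually)
    qed
    then show ?case by blast
  qed
qed

section \<open>Herglotz integrals and outer functions\<close>

text \<open>This is the exponent in \<open>outer_function\<close> with \<open>u\<close> in the role
  of \<open>ln \<psi>\<close>; for integrable \<open>u\<close> its real part on the disk is the
  Poisson integral of \<open>u\<close>.\<close>

definition herglotz :: "(complex \<Rightarrow> real) \<Rightarrow> complex \<Rightarrow> complex" where
  "herglotz u z = (LINT \<zeta>|circle_measure. (\<zeta> + z) / (\<zeta> - z) * of_real (u \<zeta>))"

lemma integrable_herglotz:
  assumes u: "integrable circle_measure u" and z: "norm z < 1"
  shows "integrable circle_measure (\<lambda>\<zeta>. (\<zeta> + z) / (\<zeta> - z) * complex_of_real (u \<zeta>))"
proof (rule Bochner_Integration.integrable_bound)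
  show "integrable circle_measure (\<lambda>\<zeta>. 2 / (1 - norm z) * u \<zeta>)"
    using u by simp
  have [measurable]: "u \<in> borel_measurable borel"
    using u by (auto dest: borel_measurable_integrable)
  show "(\<lambda>\<zeta>. (\<zeta> + z) / (\<zeta> - z) * complex_of_real (u \<zeta>)) \<in> borel_measurable circle_measure"
    by measurable
  show "AE \<zeta> in circle_measure. norm ((\<zeta> + z) / (\<zeta> - z) * complex_of_real (u \<zeta>)) \<le> norm (2 / (1 - norm z) * u \<zeta>)"
    using AE_circle_measure_norm
  proof eventually_elim
    case (elim \<zeta>)
    have "norm (\<zeta> + z) \<le> 2" using norm_triangle_ineq[of \<zeta> z] elim z by simp
    then have "norm (\<zeta> + z) / norm (\<zeta> - z) \<le> 2 / (1 - norm z)"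
      using norm_diff_ge_circle[OF elim, of z] z by (intro frac_le) auto
    from mult_right_mono[OF this, of "\<bar>u \<zeta>\<bar>"] show ?case
      using z by (simp add: norm_mult norm_divide abs_mult)
  qed
qed

lemma Re_herglotz_kernel:
  assumes "norm \<zeta> = 1"
  shows "Re ((\<zeta> + z) / (\<zeta> - z)) = poisson_kernel z \<zeta>"
proof -
  have "Re ((\<zeta> + z) * cnj (\<zeta> - z)) = 1 - (norm z)\<^sup>2"
    using assms cmod_power2[of \<zeta>] cmod_power2[of z] by (simp add: power2_eq_square algebra_simps)
  then show ?thesis
    unfolding poisson_kernel_def by (metis Re_divide_of_real complex_div_cnj of_real_power)
qed

lemma Re_herglotz:
  assumes u: "integrable circle_measure u" and z: "norm z < 1"
  shows "Re (herglotz u z) = (LINT \<zeta>|circle_measure. poisson_kernel z \<zeta> * u \<zeta>)"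
proof -
  have [measurable]: "u \<in> borel_measurable borel"
    using u by (auto dest: borel_measurable_integrable)
  have "Re (herglotz u z) = (LINT \<zeta>|circle_measure. Re ((\<zeta> + z) / (\<zeta> - z) * complex_of_real (u \<zeta>)))"
    unfolding herglotz_def by (intro integral_Re[symmetric] integrable_herglotz u z)
  also have "\<dots> = (LINT \<zeta>|circle_measure. poisson_kernel z \<zeta> * u \<zeta>)"
  proof (rule integral_cong_AE)
    have "Re (w * complex_of_real x) = Re w * x" for w x by simp
    note eq = this Re_herglotz_kernel
    show "AE \<zeta> in circle_measure. Re ((\<zeta> + z) / (\<zeta> - z) * complex_of_real (u \<zeta>)) = poisson_kernel z \<zeta> * u \<zeta>"
      using AE_circle_measure_norm by eventually_elim (simp only: eq)
  qed measurable
  finally show ?thesis .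
qed

text \<open>For \<zeta> on the circle, half of the kernel plus one is the geometric series in z
  \<open>cnj \<zeta>\<close>. Hence \<open>S\<close>, half the sum of the Herglotz integral and the
  mean of \<open>u\<close>, is a power series with the coefficients \<open>c n\<close>.\<close>

lemma holomorphic_herglotz:
  assumes u: "integrable circle_measure u"
  shows "herglotz u holomorphic_on ball 0 1"
proof -
  have u_meas [measurable]: "u \<in> borel_measurable borel"
    using u by (auto dest: borel_measurable_integrable)
  define c where "c n = (LINT \<zeta>|circle_measure. cnj \<zeta> ^ n * complex_of_real (u \<zeta>))" for n
  define S where "S z = (herglotz u z + of_real (LINT \<zeta>|circle_measure. u \<zeta>)) / 2" for z
  have cnj_measurable [measurable]: "cnj \<in> borel_measurable borel"
    by (intro borel_measurable_continuous_onI continuous_intros)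
  have int: "integrable circle_measure (\<lambda>\<zeta>. cnj \<zeta> ^ n * complex_of_real (u \<zeta>))" for n
  proof (rule Bochner_Integration.integrable_bound[OF u])
    show "AE \<zeta> in circle_measure. norm (cnj \<zeta> ^ n * complex_of_real (u \<zeta>)) \<le> norm (u \<zeta>)"
      using AE_circle_measure_norm by eventually_elim (simp add: norm_mult norm_power)
  qed measurable
  have "(\<lambda>n. c n * (z - 0) ^ n) sums S z" if "z \<in> ball 0 1" for z
  proof -
    have z: "norm z < 1" using that by simp
    define F where "F n \<zeta> = z ^ n * (cnj \<zeta> ^ n * complex_of_real (u \<zeta>))" for n \<zeta>
    have F_int: "integrable circle_measure (F n)" for n
      unfolding F_def by (intro integrable_mult_right int)
    have F_norm: "norm (F n \<zeta>) = norm z ^ n * \<bar>u \<zeta>\<bar>" if "norm \<zeta> = 1" for n \<zeta>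
      using that by (simp add: F_def norm_mult norm_power)
    have "(\<lambda>n. LINT \<zeta>|circle_measure. F n \<zeta>) sums (LINT \<zeta>|circle_measure. (\<Sum>n. F n \<zeta>))"
    proof (rule sums_integral)
      show "AE \<zeta> in circle_measure. summable (\<lambda>n. norm (F n \<zeta>))"
        using AE_circle_measure_norm
        by eventually_elim (use z in \<open>auto simp: F_norm intro!: summable_mult2 summable_geometric\<close>)
      have "(LINT \<zeta>|circle_measure. norm (F n \<zeta>)) = norm z ^ n * (LINT \<zeta>|circle_measure. \<bar>u \<zeta>\<bar>)" for n
      proof -
        have "(LINT \<zeta>|circle_measure. norm (F n \<zeta>)) = (LINT \<zeta>|circle_measure. norm z ^ n * \<bar>u \<zeta>\<bar>)"
        proof (rule integral_cong_AE)
          show "AE \<zeta> in circle_measure. norm (F n \<zeta>) = norm z ^ n * \<bar>u \<zeta>\<bar>"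
            using AE_circle_measure_norm by eventually_elim (rule F_norm)
        qed (use borel_measurable_integrable[OF F_int] in measurable)
        then show ?thesis by simp
      qed
      then show "summable (\<lambda>n. LINT \<zeta>|circle_measure. norm (F n \<zeta>))"
        using z by (auto intro!: summable_mult2 summable_geometric)
    qed (rule F_int)
    moreover have "(LINT \<zeta>|circle_measure. (\<Sum>n. F n \<zeta>)) = S z"
    proof -
      have "(LINT \<zeta>|circle_measure. (\<Sum>n. F n \<zeta>)) =
          (LINT \<zeta>|circle_measure. ((\<zeta> + z) / (\<zeta> - z) * complex_of_real (u \<zeta>) + complex_of_real (u \<zeta>)) / 2)"
      proof (rule integral_cong_AE)
        show "AE \<zeta> in circle_measure. (\<Sum>n. F n \<zeta>) = ((\<zeta> + z) / (\<zeta> - z) * complex_of_real (u \<zeta>) + complex_of_real (u \<zeta>)) / 2"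
          using AE_circle_measure_norm
        proof eventually_elim
          case (elim \<zeta>)
          have \<zeta>: "\<zeta> * cnj \<zeta> = 1" using complex_norm_square[of \<zeta>] elim by simp
          have "norm (z * cnj \<zeta>) < 1" using z elim by (simp add: norm_mult)
          then have "(\<lambda>n. (z * cnj \<zeta>) ^ n) sums (1 / (1 - z * cnj \<zeta>))" by (rule geometric_sums)
          then have "(\<lambda>n. (z * cnj \<zeta>) ^ n * of_real (u \<zeta>)) sums (1 / (1 - z * cnj \<zeta>) * of_real (u \<zeta>))"
            by (rule sums_mult2)
          then have 1: "(\<Sum>n. F n \<zeta>) = 1 / (1 - z * cnj \<zeta>) * of_real (u \<zeta>)"
            by (simp add: F_def sums_iff power_mult_distrib mult_ac)
          have nz: "\<zeta> - z \<noteq> 0" "\<zeta> \<noteq> 0" using z elim by auto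
          have "\<zeta> - z = \<zeta> * (1 - z * cnj \<zeta>)" using \<zeta> by (simp add: algebra_simps)
          then have "1 / (1 - z * cnj \<zeta>) = \<zeta> / (\<zeta> - z)" using nz by simp
          also have "\<dots> = ((\<zeta> + z) / (\<zeta> - z) + 1) / 2" using nz by (simp add: field_simps)
          finally have 2: "1 / (1 - z * cnj \<zeta>) = ((\<zeta> + z) / (\<zeta> - z) + 1) / 2" .
          show ?case unfolding 1 2 by (simp add: algebra_simps add_divide_distrib)
        qed
        show "(\<lambda>\<zeta>. \<Sum>n. F n \<zeta>) \<in> borel_measurable circle_measure"
          using borel_measurable_integrable[OF F_int] by measurable
      qed measurable
      also have "\<dots> = S z"
        using integrable_herglotz[OF u z] u
        by (simp add: S_def herglotz_def)
      finally show ?thesis .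
    qed
    moreover have "(LINT \<zeta>|circle_measure. F n \<zeta>) = c n * (z - 0) ^ n" for n
      unfolding F_def c_def using int by simp
    ultimately show ?thesis by simp
  qed
  then have "S holomorphic_on ball 0 1" by (rule power_series_holomorphic)
  then have "(\<lambda>z. 2 * S z - of_real (LINT \<zeta>|circle_measure. u \<zeta>)) holomorphic_on ball 0 1"
    by (intro holomorphic_intros)
  moreover have "(\<lambda>z. 2 * S z - of_real (LINT \<zeta>|circle_measure. u \<zeta>)) = herglotz u"
    by (simp add: S_def fun_eq_iff field_simps)
  ultimately show ?thesis by simp
qed

section \<open>Boundary values of Smirnov functions\<close>

lemma tendsto_nontangential_iff:
  "(f \<longlongrightarrow> l) (nontangential \<zeta>) \<longleftrightarrow> (\<forall>\<alpha>>1. (f \<longlongrightarrow> l) (at \<zeta> within stolz_region \<alpha> \<zeta>))"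
  unfolding nontangential_def tendsto_def eventually_Sup by auto

lemma eventually_nontangential_ball: "eventually (\<lambda>z. z \<in> ball 0 1) (nontangential \<zeta>)"
  unfolding nontangential_def eventually_Sup
  by (auto simp: eventually_at_filter stolz_region_def intro!: always_eventually)

text \<open>On the radius the distance to \<zeta> equals 1 - \<open>norm z\<close>, so the points
  lie in the Stolz region of aperture 2. The sequence makes limits unique and boundary values
  measurable; the shift by 2 keeps all radii positive.\<close>

lemma radial_filterlim_nontangential:
  assumes \<zeta>: "norm \<zeta> = 1"
  shows "filterlim (\<lambda>n. complex_of_real (1 - 1 / (real n + 2)) * \<zeta>) (nontangential \<zeta>) sequentially"
proof -
  let ?z = "\<lambda>n. complex_of_real (1 - 1 / (real n + 2)) * \<zeta>"
  have "(\<lambda>n. 1 - 1 / (real n + 2)) \<longlonglongrightarrow> 1" by real_asymp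
  then have "?z \<longlonglongrightarrow> of_real 1 * \<zeta>" by (intro tendsto_intros)
  moreover have "?z n \<in> stolz_region 2 \<zeta> \<and> ?z n \<noteq> \<zeta>" for n
  proof -
    have eq: "?z n - \<zeta> = - complex_of_real (1 / (real n + 2)) * \<zeta>" by (simp add: algebra_simps)
    have "norm (?z n) = 1 - 1 / (real n + 2)" using \<zeta> by (simp add: norm_mult del: of_real_diff of_real_divide)
    moreover have "norm (?z n - \<zeta>) = 1 / (real n + 2)"
      unfolding eq using \<zeta> by (simp add: norm_mult del: of_real_diff of_real_divide)
    moreover have "0 < 1 / (real n + 2)" by simp
    ultimately show ?thesis unfolding stolz_region_def dist_norm mem_ball_0
      by (auto intro: divide_strict_right_mono)
  qed
  ultimately have "filterlim ?z (at \<zeta> within stolz_region 2 \<zeta>) sequentially"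
    by (auto simp: filterlim_at intro!: always_eventually)
  moreover have "at \<zeta> within stolz_region 2 \<zeta> \<le> nontangential \<zeta>"
    unfolding nontangential_def by (intro SUP_upper) auto
  ultimately show ?thesis by (rule filterlim_mono) auto
qed

lemma nontangential_neq_bot:
  assumes "norm \<zeta> = 1"
  shows "nontangential \<zeta> \<noteq> bot"
proof
  assume "nontangential \<zeta> = bot"
  then have "filtermap (\<lambda>n. complex_of_real (1 - 1 / (real n + 2)) * \<zeta>) sequentially = bot"
    using radial_filterlim_nontangential[OF assms] by (simp only: filterlim_def le_bot)
  then show False by (simp add: filtermap_bot_iff)
qed

lemma boundary_value_eqI:
  assumes "norm \<zeta> = 1" "(f \<longlongrightarrow> l) (nontangential \<zeta>)"
  shows "boundary_value f \<zeta> = l"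
  unfolding boundary_value_def by (intro tendsto_Lim nontangential_neq_bot assms)

text \<open>Convergence is stated explicitly because \<open>boundary_value\<close> has some value at
  every point. The condition \<open>norm \<zeta> = 1\<close> makes the filter nontrivial.\<close>

definition has_boundary_value :: "(complex \<Rightarrow> complex) \<Rightarrow> complex \<Rightarrow> bool" where
  "has_boundary_value f \<zeta> \<longleftrightarrow> norm \<zeta> = 1 \<and> (f \<longlongrightarrow> boundary_value f \<zeta>) (nontangential \<zeta>)"

lemma has_boundary_valueI:
  assumes "norm \<zeta> = 1" "(f \<longlongrightarrow> l) (nontangential \<zeta>)"
  shows "has_boundary_value f \<zeta>"
  using assms boundary_value_eqI[OF assms] by (simp add: has_boundary_value_def)

lemma HinfI:
  assumes "f holomorphic_on ball 0 1" "\<And>z. norm z < 1 \<Longrightarrow> norm (f z) \<le> B"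
  shows "f \<in> Hinf"
  using assms by (auto simp: Hinf_def bounded_iff intro!: exI[of _ B])

lemma HinfE:
  assumes "f \<in> Hinf"
  obtains B where "f holomorphic_on ball 0 1" "\<And>z. norm z < 1 \<Longrightarrow> norm (f z) \<le> B"
proof -
  have "bounded (f ` ball 0 1)" using assms by (simp add: Hinf_def)
  then obtain B where "\<forall>z\<in>ball 0 1. norm (f z) \<le> B"
    unfolding bounded_iff by blast
  then show thesis using assms by (intro that[of B]) (simp_all add: Hinf_def)
qed

lemma Hinf_has_boundary_value:
  assumes "f \<in> Hinf"
  shows "AE \<zeta> in circle_measure. has_boundary_value f \<zeta>"
  using fatou_Hinf[OF assms] AE_circle_measure_norm
  by eventually_elim (auto simp: tendsto_nontangential_iff intro: has_boundary_valueI)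

text \<open>The logarithm of \<open>norm (h z)\<close> is the Poisson integral of \<open>u\<close>,
  so Fatou's theorem for Poisson integrals applies before exponentiating.\<close>

lemma outer_norm_tendsto:
  assumes u: "integrable circle_measure u" and c: "norm c = 1"
    and h: "\<And>z. z \<in> ball 0 1 \<Longrightarrow> h z = c * exp (herglotz u z)"
  shows "AE \<zeta> in circle_measure. ((\<lambda>z. norm (h z)) \<longlongrightarrow> exp (u \<zeta>)) (nontangential \<zeta>)"
proof -
  have "integrable circle_measure (\<lambda>\<zeta>. complex_of_real (u \<zeta>))"
    using u by (rule integrable_of_real)
  from fatou_poisson[OF this] show ?thesis
  proof eventually_elim
    case (elim \<zeta>)
    then have "((\<lambda>z. LINT \<xi>|circle_measure. poisson_kernel z \<xi> *\<^sub>R complex_of_real (u \<xi>)) \<longlongrightarrow> of_real (u \<zeta>))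
        (nontangential \<zeta>)"
      by (simp add: tendsto_nontangential_iff)
    then have "((\<lambda>z. exp (Re (LINT \<xi>|circle_measure. poisson_kernel z \<xi> *\<^sub>R complex_of_real (u \<xi>)))) \<longlongrightarrow>
        exp (Re (of_real (u \<zeta>)))) (nontangential \<zeta>)"
      by (intro tendsto_intros)
    moreover have "eventually (\<lambda>z. exp (Re (LINT \<xi>|circle_measure. poisson_kernel z \<xi> *\<^sub>R complex_of_real (u \<xi>))) = norm (h z))
        (nontangential \<zeta>)"
      using eventually_nontangential_ball
    proof eventually_elim
      case (elim z)
      have "(LINT \<xi>|circle_measure. poisson_kernel z \<xi> *\<^sub>R complex_of_real (u \<xi>)) =
          of_real (LINT \<xi>|circle_measure. poisson_kernel z \<xi> * u \<xi>)"
        by (simp add: scaleR_conv_of_real flip: of_real_mult)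
      then show ?case
        using elim h[OF elim] c Re_herglotz[OF u] by (simp add: norm_mult)
    qed
    ultimately show ?case by (auto elim: Lim_transform_eventually)
  qed
qed

section \<open>Zero-freeness of outer functions inside the disk and on the boundary\<close>

lemma outer_functionE:
  assumes "outer_function h"
  obtains c u where "norm c = 1" "integrable circle_measure u"
    "\<And>z. z \<in> ball 0 1 \<Longrightarrow> h z = c * exp (herglotz u z)"
proof -
  from assms obtain c \<psi> where "norm c = 1" "integrable circle_measure (\<lambda>\<zeta>. ln (\<psi> \<zeta>))"
    "\<forall>z\<in>ball 0 1. h z = c * exp (LINT \<zeta>|circle_measure. (\<zeta> + z) / (\<zeta> - z) * of_real (ln (\<psi> \<zeta>)))"
    unfolding outer_function_def by (elim exE conjE) (rule that)
  then show thesis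
    by (intro that[of c "\<lambda>\<zeta>. ln (\<psi> \<zeta>)"]) (simp_all add: herglotz_def)
qed

lemma outer_functionI:
  assumes "norm c = 1" "integrable circle_measure u"
    "\<And>z. z \<in> ball 0 1 \<Longrightarrow> h z = c * exp (herglotz u z)"
  shows "outer_function h"
  unfolding outer_function_def
  by (rule exI[of _ c], rule exI[of _ "\<lambda>\<zeta>. exp (u \<zeta>)"]) (use assms in \<open>simp add: herglotz_def\<close>)

lemma outer_function_nonzero: "outer_function h \<Longrightarrow> z \<in> ball 0 1 \<Longrightarrow> h z \<noteq> 0"
  by (erule outer_functionE) (simp, metis exp_not_eq_zero norm_zero zero_neq_one)

text \<open>Uniqueness of limits identifies the modulus of the boundary value with the exponential
  of a real number.\<close>

lemma outer_boundary_value_nonzero: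
  assumes h: "h \<in> Hinf" and "outer_function h"
  shows "AE \<zeta> in circle_measure. boundary_value h \<zeta> \<noteq> 0"
proof -
  obtain c u where u: "norm c = 1" "integrable circle_measure u"
    "\<And>z. z \<in> ball 0 1 \<Longrightarrow> h z = c * exp (herglotz u z)"
    using assms(2) by (rule outer_functionE) (rule that)
  have "AE \<zeta> in circle_measure. ((\<lambda>z. norm (h z)) \<longlongrightarrow> exp (u \<zeta>)) (nontangential \<zeta>)"
    by (rule outer_norm_tendsto) (fact u)+
  then show ?thesis
    using Hinf_has_boundary_value[OF h]
  proof eventually_elim
    case (elim \<zeta>)
    have "norm (boundary_value h \<zeta>) = exp (u \<zeta>)"
      using elim unfolding has_boundary_value_def
      by (elim conjE) (rule tendsto_unique[OF nontangential_neq_bot tendsto_norm])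
    then show ?case by auto
  qed
qed

section \<open>Boundary behaviour and products in the Smirnov class\<close>

lemma smirnovE:
  assumes "f \<in> smirnov"
  obtains g h where "g \<in> Hinf" "h \<in> Hinf" "outer_function h"
    "\<And>z. z \<in> ball 0 1 \<Longrightarrow> f z = g z / h z"
  using assms unfolding smirnov_def by blast

lemma smirnovI:
  assumes "g \<in> Hinf" "h \<in> Hinf" "outer_function h"
    "\<And>z. z \<in> ball 0 1 \<Longrightarrow> f z = g z / h z"
  shows "f \<in> smirnov"
  unfolding smirnov_def using assms by auto

lemma smirnov_holomorphic:
  assumes "f \<in> smirnov"
  shows "f holomorphic_on ball 0 1"
proof -
  obtain g h where gh: "g \<in> Hinf" "h \<in> Hinf" "outer_function h" "\<And>z. z \<in> ball 0 1 \<Longrightarrow> f z = g z / h z"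
    using assms by (rule smirnovE) (rule that)
  then have "(\<lambda>z. g z / h z) holomorphic_on ball 0 1"
    by (intro holomorphic_on_divide) (auto simp: Hinf_def outer_function_nonzero)
  then show ?thesis by (rule holomorphic_transform) (simp add: gh(4))
qed

text \<open>Numerator and denominator are bounded, and the limit of the outer denominator is nonzero
  almost everywhere.\<close>

lemma smirnov_has_boundary_value:
  assumes "f \<in> smirnov"
  shows "AE \<zeta> in circle_measure. has_boundary_value f \<zeta>"
proof -
  obtain g h where gh: "g \<in> Hinf" "h \<in> Hinf" "outer_function h" "\<And>z. z \<in> ball 0 1 \<Longrightarrow> f z = g z / h z"
    using assms by (rule smirnovE) (rule that)
  show ?thesis
    using Hinf_has_boundary_value[OF gh(1)] Hinf_has_boundary_value[OF gh(2)]
      outer_boundary_value_nonzero[OF gh(2,3)]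
  proof eventually_elim
    case (elim \<zeta>)
    have "((\<lambda>z. g z / h z) \<longlongrightarrow> boundary_value g \<zeta> / boundary_value h \<zeta>) (nontangential \<zeta>)"
      using elim by (intro tendsto_intros) (auto simp: has_boundary_value_def)
    moreover have "eventually (\<lambda>z. g z / h z = f z) (nontangential \<zeta>)"
      using eventually_nontangential_ball by eventually_elim (simp add: gh(4))
    ultimately have "(f \<longlongrightarrow> boundary_value g \<zeta> / boundary_value h \<zeta>) (nontangential \<zeta>)"
      by (rule Lim_transform_eventually)
    then show ?case using elim by (intro has_boundary_valueI) (auto simp: has_boundary_value_def)
  qed
qed

lemma boundary_value_mult:
  assumes "has_boundary_value f \<zeta>" "has_boundary_value g \<zeta>"
  shows "boundary_value (\<lambda>z. f z * g z) \<zeta> = boundary_value f \<zeta> * boundary_value g \<zeta>"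
  using assms by (intro boundary_value_eqI tendsto_mult) (auto simp: has_boundary_value_def)

text \<open>On the exceptional null set \<open>boundary_value f\<close> is unspecified, so a Borel
  representative takes its place: the limit along a sequence of radii, whose members are continuous
  on the circle.\<close>

lemma boundary_value_measurable:
  assumes "f \<in> smirnov"
  obtains m where "m \<in> borel_measurable borel" "AE \<zeta> in circle_measure. boundary_value f \<zeta> = m \<zeta>"
proof
  let ?r = "\<lambda>n. 1 - 1 / (real n + 2)"
  let ?x = "\<lambda>n \<zeta>. indicator (sphere 0 1) \<zeta> *\<^sub>R f (complex_of_real (?r n) * \<zeta>)"
  have "?x n \<in> borel_measurable borel" for n
  proof (intro borel_measurable_continuous_on_indicator)
    have "0 < ?r n" "?r n < 1" by auto
    then show "continuous_on (sphere 0 1) (\<lambda>\<zeta>. f (complex_of_real (?r n) * \<zeta>))"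
      by (intro continuous_dilated_sphere smirnov_holomorphic assms)
  qed (simp add: borel_closed)
  then show "(\<lambda>\<zeta>. lim (\<lambda>n. ?x n \<zeta>)) \<in> borel_measurable borel" by measurable
  show "AE \<zeta> in circle_measure. boundary_value f \<zeta> = lim (\<lambda>n. ?x n \<zeta>)"
    using smirnov_has_boundary_value[OF assms]
  proof eventually_elim
    case (elim \<zeta>)
    then have "(\<lambda>n. f (complex_of_real (?r n) * \<zeta>)) \<longlonglongrightarrow> boundary_value f \<zeta>"
      unfolding has_boundary_value_def
      by (intro filterlim_compose[OF _ radial_filterlim_nontangential]) simp_all
    then show ?case using elim by (simp add: limI has_boundary_value_def)
  qed
qed

text \<open>Numerators and denominators multiply separately; the product of the outer denominators
  is outer because \<open>herglotz\<close> is additive on integrable functions.\<close>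

lemma smirnov_mult:
  assumes "f1 \<in> smirnov" "f2 \<in> smirnov"
  shows "(\<lambda>z. f1 z * f2 z) \<in> smirnov"
proof -
  obtain g1 h1 where 1: "g1 \<in> Hinf" "h1 \<in> Hinf" "outer_function h1" "\<And>z. z \<in> ball 0 1 \<Longrightarrow> f1 z = g1 z / h1 z"
    using assms(1) by (rule smirnovE) (rule that)
  obtain g2 h2 where 2: "g2 \<in> Hinf" "h2 \<in> Hinf" "outer_function h2" "\<And>z. z \<in> ball 0 1 \<Longrightarrow> f2 z = g2 z / h2 z"
    using assms(2) by (rule smirnovE) (rule that)
  have Hinf_mult: "(\<lambda>z. a z * b z) \<in> Hinf" if "a \<in> Hinf" "b \<in> Hinf" for a b
  proof -
    obtain A where A: "a holomorphic_on ball 0 1" "\<And>z. norm z < 1 \<Longrightarrow> norm (a z) \<le> A"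
      using \<open>a \<in> Hinf\<close> by (rule HinfE) (rule that)
    obtain B where B: "b holomorphic_on ball 0 1" "\<And>z. norm z < 1 \<Longrightarrow> norm (b z) \<le> B"
      using \<open>b \<in> Hinf\<close> by (rule HinfE) (rule that)
    show ?thesis
    proof (rule HinfI)
      show "norm (a z * b z) \<le> A * B" if "norm z < 1" for z
        unfolding norm_mult using that A(2) B(2) by (intro mult_mono') auto
    qed (intro holomorphic_intros A B)
  qed
  obtain c1 u1 where o1: "norm c1 = 1" "integrable circle_measure u1"
    "\<And>z. z \<in> ball 0 1 \<Longrightarrow> h1 z = c1 * exp (herglotz u1 z)"
    using 1(3) by (rule outer_functionE) (rule that)
  obtain c2 u2 where o2: "norm c2 = 1" "integrable circle_measure u2"
    "\<And>z. z \<in> ball 0 1 \<Longrightarrow> h2 z = c2 * exp (herglotz u2 z)"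
    using 2(3) by (rule outer_functionE) (rule that)
  have "outer_function (\<lambda>z. h1 z * h2 z)"
  proof (rule outer_functionI)
    show "norm (c1 * c2) = 1" using o1 o2 by (simp add: norm_mult)
    show "integrable circle_measure (\<lambda>\<zeta>. u1 \<zeta> + u2 \<zeta>)" using o1 o2 by simp
    fix z :: complex assume z: "z \<in> ball 0 1"
    have "herglotz (\<lambda>\<zeta>. u1 \<zeta> + u2 \<zeta>) z = herglotz u1 z + herglotz u2 z"
      using Bochner_Integration.integral_add[OF integrable_herglotz[OF o1(2), of z] integrable_herglotz[OF o2(2), of z]] z
      by (simp add: herglotz_def distrib_left add_divide_distrib)
    then show "h1 z * h2 z = c1 * c2 * exp (herglotz (\<lambda>\<zeta>. u1 \<zeta> + u2 \<zeta>) z)"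
      using o1(3) o2(3) z by (simp add: exp_add)
  qed
  then show ?thesis
    by (intro smirnovI[of "\<lambda>z. g1 z * g2 z" "\<lambda>z. h1 z * h2 z"] Hinf_mult 1 2) (simp_all add: 1(4) 2(4))
qed

lemma smirnov_one: "(\<lambda>z. 1) \<in> smirnov"
proof -
  have "(\<lambda>z. 1) \<in> Hinf" by (rule HinfI[of _ 1]) auto
  moreover have "outer_function (\<lambda>z. 1)"
    by (rule outer_functionI[of 1 "\<lambda>_. 0"]) (auto simp: herglotz_def)
  ultimately show ?thesis by (intro smirnovI[of "\<lambda>_. 1" "\<lambda>_. 1"]) auto
qed

text \<open>As \<open>u\<close> is nonnegative, the outer function with boundary modulus exp(-u) is
  bounded by 1. Its reciprocal is a quotient of the form required by \<open>smirnov\<close> with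
  numerator 1.\<close>

lemma smirnov_with_modulus:
  assumes u: "integrable circle_measure u" and nonneg: "\<And>\<zeta>. 0 \<le> u \<zeta>"
  obtains F where "F \<in> smirnov" "AE \<zeta> in circle_measure. norm (boundary_value F \<zeta>) = exp (u \<zeta>)"
proof
  define h where "h z = exp (herglotz (\<lambda>\<zeta>. - u \<zeta>) z)" for z
  have u': "integrable circle_measure (\<lambda>\<zeta>. - u \<zeta>)" using u by simp
  have h_eq: "h z = 1 * exp (herglotz (\<lambda>\<zeta>. - u \<zeta>) z)" for z by (simp add: h_def)
  have outer: "outer_function h"
    by (rule outer_functionI[OF _ u' h_eq]) simp
  have "norm (h z) \<le> 1" if "norm z < 1" for z
  proof -
    have "0 \<le> (LINT \<zeta>|circle_measure. poisson_kernel z \<zeta> * u \<zeta>)"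
      using that nonneg poisson_kernel_nonneg by (intro integral_nonneg_AE) auto
    then show ?thesis
      using that Re_herglotz[OF u', of z] by (simp add: h_def)
  qed
  moreover have "h holomorphic_on ball 0 1"
    unfolding h_def by (intro holomorphic_intros holomorphic_herglotz u')
  ultimately have h: "h \<in> Hinf" by (intro HinfI)
  have "(\<lambda>z. 1) \<in> Hinf" by (rule HinfI[of _ 1]) auto
  with h outer show F: "(\<lambda>z. 1 / h z) \<in> smirnov" by (intro smirnovI) auto
  show "AE \<zeta> in circle_measure. norm (boundary_value (\<lambda>z. 1 / h z) \<zeta>) = exp (u \<zeta>)"
    using smirnov_has_boundary_value[OF F] outer_norm_tendsto[OF u' _ h_eq, simplified]
  proof eventually_elim
    case (elim \<zeta>)
    have "((\<lambda>z. norm (1 / h z)) \<longlongrightarrow> norm (boundary_value (\<lambda>z. 1 / h z) \<zeta>)) (nontangential \<zeta>)"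
      using elim(1) by (intro tendsto_norm) (simp add: has_boundary_value_def)
    moreover have "((\<lambda>z. norm (1 / h z)) \<longlongrightarrow> 1 / exp (- u \<zeta>)) (nontangential \<zeta>)"
      unfolding norm_divide norm_one using elim(2) by (intro tendsto_divide tendsto_const) auto
    ultimately have "norm (boundary_value (\<lambda>z. 1 / h z) \<zeta>) = 1 / exp (- u \<zeta>)"
      using elim(1) unfolding has_boundary_value_def
      by (elim conjE) (rule tendsto_unique[OF nontangential_neq_bot])
    then show ?case by (simp add: exp_minus inverse_eq_divide)
  qed
qed

section \<open>Strongly convex functions and multipliers\<close>

context
  fixes \<phi> :: "real \<Rightarrow> real"
  assumes sc: "strongly_convex \<phi>"
begin

lemma strongly_convex_nonneg: "0 \<le> \<phi> t"
  using sc by (simp add: strongly_convex_def)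

lemma strongly_convex_mono: "x \<le> y \<Longrightarrow> \<phi> x \<le> \<phi> y"
  using sc by (auto simp: strongly_convex_def mono_def)

text \<open>If \<phi> took equal values at \<open>a\<close> and \<open>b\<close>, the chord from a
  point \<open>c\<close> of smaller value to \<open>b\<close> would lie strictly below the graph at
  \<open>a\<close>, against convexity.\<close>

lemma strongly_convex_strict:
  assumes "Inf (range \<phi>) < \<phi> a" "a < b"
  shows "\<phi> a < \<phi> b"
proof (rule ccontr)
  assume "\<not> \<phi> a < \<phi> b"
  then have eq: "\<phi> b = \<phi> a" using strongly_convex_mono[of a b] assms(2) by simp
  obtain c where c: "\<phi> c < \<phi> a"
    using cInf_lessD[OF _ assms(1)] by auto
  then have "c < a" using strongly_convex_mono[of a c] by (meson not_le)
  have "convex_on {c..b} \<phi>"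
    using sc by (auto simp: strongly_convex_def intro: convex_on_subset)
  then have "\<phi> a \<le> (\<phi> b - \<phi> c) / (b - c) * (a - c) + \<phi> c"
    using \<open>c < a\<close> assms(2) by (intro convex_onD_Icc') auto
  also have "\<dots> = (\<phi> a - \<phi> c) * ((a - c) / (b - c)) + \<phi> c" by (simp add: eq)
  also have "\<dots> < (\<phi> a - \<phi> c) * 1 + \<phi> c"
    using c \<open>c < a\<close> assms(2) by (intro add_strict_right_mono mult_strict_left_mono) auto
  finally show False by simp
qed

text \<open>Superlinear growth gives \<open>\<phi> t\<close> at least t for large t. The bound
  yields unboundedness of \<phi>, and integrability of its inverse applied to an integrable
  function.\<close>

lemma strongly_convex_superlinear: obtains C where "0 < C" "\<And>t. t \<le> C + \<phi> t"
proof -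
  have "eventually (\<lambda>t. 1 \<le> \<phi> t / t) at_top"
    using sc by (auto simp: strongly_convex_def filterlim_at_top)
  then obtain T where T: "\<And>t. T \<le> t \<Longrightarrow> 1 \<le> \<phi> t / t"
    by (auto simp: eventually_at_top_linorder)
  show thesis
  proof (rule that[of "max T 1"])
    fix t
    show "t \<le> max T 1 + \<phi> t"
    proof (cases "t \<le> max T 1")
      case True
      then show ?thesis using strongly_convex_nonneg[of t] by linarith
    next
      case False
      then have "T \<le> t" "0 < t" by auto
      then show ?thesis using T[of t] by (simp add: le_divide_eq)
    qed
  qed simp
qed

text \<open>A finite convex function on the line is continuous, so the intermediate value theorem
  applies between a point of value below \<open>s\<close> and \<open>C + s\<close>.\<close>

lemma strongly_convex_surj:
  assumes "Inf (range \<phi>) < s"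
  shows "\<exists>t. \<phi> t = s"
proof -
  obtain a where a: "\<phi> a < s"
    using cInf_lessD[OF _ assms] by auto
  obtain C where C: "0 < C" "\<And>t. t \<le> C + \<phi> t"
    by (rule strongly_convex_superlinear) (rule that)
  have b: "s \<le> \<phi> (C + s)" using C(2)[of "C + s"] by simp
  then have "a \<le> C + s" using a strongly_convex_mono[of "C + s" a] by linarith
  have "continuous_on UNIV \<phi>"
    using sc by (intro convex_on_continuous) (auto simp: strongly_convex_def)
  then have "continuous_on {a..C + s} \<phi>" by (rule continuous_on_subset) simp
  then show ?thesis
    using IVT'[of \<phi> a s "C + s"] a b \<open>a \<le> C + s\<close> by auto
qed

lemma strongly_convex_sc_inverse: "Inf (range \<phi>) < s \<Longrightarrow> \<phi> (sc_inverse \<phi> s) = s"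
  unfolding sc_inverse_def using strongly_convex_surj by (intro f_inv_into_f) blast

lemma sc_inverse_strongly_convex:
  assumes "Inf (range \<phi>) < \<phi> t"
  shows "sc_inverse \<phi> (\<phi> t) = t"
  unfolding sc_inverse_def
proof (rule inv_into_f_f)
  show "inj_on \<phi> {t. Inf (range \<phi>) < \<phi> t}"
    by (rule inj_onI) (metis linorder_neqE_linordered_idom mem_Collect_eq order_less_irrefl strongly_convex_strict)
qed (use assms in simp)

lemma sc_inverse_mono:
  assumes "Inf (range \<phi>) < s" "s \<le> s'"
  shows "sc_inverse \<phi> s \<le> sc_inverse \<phi> s'"
proof (rule ccontr)
  assume "\<not> ?thesis"
  then have "\<phi> (sc_inverse \<phi> s') < \<phi> (sc_inverse \<phi> s)"
    using assms by (intro strongly_convex_strict) (simp_all add: strongly_convex_sc_inverse)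
  then show False using assms by (simp add: strongly_convex_sc_inverse)
qed

lemma comp_log_nonneg: "0 \<le> comp_log \<phi> x"
  by (simp add: comp_log_def strongly_convex_nonneg)

lemma comp_log_mono: "mono (comp_log \<phi>)"
  by (auto simp: mono_def comp_log_def strongly_convex_nonneg intro!: strongly_convex_mono)

lemma comp_log_measurable: "comp_log \<phi> \<in> borel_measurable borel"
  by (intro borel_measurable_mono comp_log_mono)

end

section \<open>Pointwise comparison of the two defining functions\<close>

text \<open>In logarithmic variables, \<open>l\<close> stands for log |f| and \<gamma> for log |g|.
  Passing from \<open>s\<close> to \<open>s'\<close> raises \<open>sc_inverse \<phi>1\<close> by
  exactly \<gamma>, so the monotone difference forces \<open>sc_inverse \<phi>2\<close> up by at
  least \<gamma>.\<close>

lemma strongly_convex_transfer: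
  assumes sc1: "strongly_convex \<phi>1" and sc2: "strongly_convex \<phi>2"
    and mono: "mono_on (inverse_dom \<phi>1 \<inter> inverse_dom \<phi>2) (\<lambda>s. sc_inverse \<phi>2 s - sc_inverse \<phi>1 s)"
    and s: "Inf (range \<phi>1) < s" "Inf (range \<phi>2) < s" "\<phi>2 l \<le> s" and \<gamma>: "0 \<le> \<gamma>"
  shows "\<phi>2 (\<gamma> + l) \<le> \<phi>1 (\<gamma> + sc_inverse \<phi>1 s)"
proof -
  define s' where "s' = \<phi>1 (\<gamma> + sc_inverse \<phi>1 s)"
  have "s \<le> s'"
    using strongly_convex_mono[OF sc1, of "sc_inverse \<phi>1 s" "\<gamma> + sc_inverse \<phi>1 s"] s(1) \<gamma>
    by (simp add: s'_def strongly_convex_sc_inverse[OF sc1])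
  have "sc_inverse \<phi>2 s - sc_inverse \<phi>1 s \<le> sc_inverse \<phi>2 s' - sc_inverse \<phi>1 s'"
    using s \<open>s \<le> s'\<close> by (intro mono_onD[OF mono]) (auto simp: inverse_dom_def)
  moreover have "sc_inverse \<phi>1 s' = \<gamma> + sc_inverse \<phi>1 s"
    using s(1) \<open>s \<le> s'\<close> unfolding s'_def by (intro sc_inverse_strongly_convex[OF sc1]) simp
  ultimately have *: "\<gamma> + sc_inverse \<phi>2 s \<le> sc_inverse \<phi>2 s'" by simp
  \<comment> \<open>Applying the inverse to \<open>\<phi>2 l\<close> is not possible when this value
    is the infimum, hence the argument by contradiction.\<close>
  have "l \<le> sc_inverse \<phi>2 s"
  proof (rule ccontr)
    assume "\<not> ?thesis"
    then have "\<phi>2 (sc_inverse \<phi>2 s) < \<phi>2 l"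
      using s(2) by (intro strongly_convex_strict[OF sc2]) (simp_all add: strongly_convex_sc_inverse[OF sc2])
    then show False using s by (simp add: strongly_convex_sc_inverse[OF sc2])
  qed
  with * have "\<phi>2 (\<gamma> + l) \<le> \<phi>2 (sc_inverse \<phi>2 s')"
    by (intro strongly_convex_mono[OF sc2]) simp
  also have "\<dots> = s'"
    using s(2) \<open>s \<le> s'\<close> by (intro strongly_convex_sc_inverse[OF sc2]) simp
  finally show ?thesis by (simp add: s'_def)
qed

text \<open>The first summand suffices for \<open>y\<close> at most 1 and the second for larger
  \<open>y\<close>; taking their sum avoids splitting the circle under the integral.\<close>

lemma comp_log_mult_le:
  assumes sc1: "strongly_convex \<phi>1" and sc2: "strongly_convex \<phi>2"
    and mono: "mono_on (inverse_dom \<phi>1 \<inter> inverse_dom \<phi>2) (\<lambda>s. sc_inverse \<phi>2 s - sc_inverse \<phi>1 s)"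
    and s: "Inf (range \<phi>1) < s" "Inf (range \<phi>2) < s" "comp_log \<phi>2 x \<le> s"
    and xy: "0 \<le> x" "0 \<le> y"
  shows "comp_log \<phi>2 (y * x) \<le> comp_log \<phi>2 x + comp_log \<phi>1 (y * exp (sc_inverse \<phi>1 s))"
\<comment> \<open>The point x = 0 corresponds to log x = -\<infinity>, where the product is 0 as
  well and there is no real \<open>l\<close> to insert.\<close>
proof (cases "y \<le> 1 \<or> x = 0")
  case True
  then have "y * x \<le> x" using xy by (auto simp: mult_left_le_one_le)
  then have "comp_log \<phi>2 (y * x) \<le> comp_log \<phi>2 x" by (rule monoD[OF comp_log_mono[OF sc2]])
  then show ?thesis using comp_log_nonneg[OF sc1, of "y * exp (sc_inverse \<phi>1 s)"] by linarith
next
  case False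
  then have xy': "1 < y" "0 < x" using xy by auto
  have "comp_log \<phi>2 (y * x) = \<phi>2 (ln y + ln x)"
    using xy' by (simp add: comp_log_def ln_mult mult_le_0_iff)
  also have "\<dots> \<le> \<phi>1 (ln y + sc_inverse \<phi>1 s)"
    using s xy' by (intro strongly_convex_transfer[OF sc1 sc2 mono]) (auto simp: comp_log_def)
  also have "\<dots> = comp_log \<phi>1 (y * exp (sc_inverse \<phi>1 s))"
    using xy' by (simp add: comp_log_def ln_mult mult_le_0_iff)
  finally show ?thesis using comp_log_nonneg[OF sc2, of x] by linarith
qed

theorem proposition4p1:
  fixes \<phi>1 \<phi>2 :: "real \<Rightarrow> real"
  assumes "strongly_convex \<phi>1" and "strongly_convex \<phi>2"
    and "mono_on (inverse_dom \<phi>1 \<inter> inverse_dom \<phi>2)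
           (\<lambda>s. sc_inverse \<phi>2 s - sc_inverse \<phi>1 s)"
  shows "Mult (hardy_orlicz (comp_log \<phi>1)) \<subseteq> Mult (hardy_orlicz (comp_log \<phi>2))"
proof
  fix g assume g: "g \<in> Mult (hardy_orlicz (comp_log \<phi>1))"
  note sc1 = assms(1) and sc2 = assms(2)
  note [measurable] = comp_log_measurable[OF sc1] comp_log_measurable[OF sc2]
  have holo: "g holomorphic_on ball 0 1"
    and mult: "\<And>f. f \<in> hardy_orlicz (comp_log \<phi>1) \<Longrightarrow> (\<lambda>z. g z * f z) \<in> hardy_orlicz (comp_log \<phi>1)"
    using g by (auto simp: Mult_def)
  \<comment> \<open>Testing the multiplier on the constant 1 puts \<open>g\<close> itself into the
    Smirnov class, which provides its boundary values.\<close>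
  have "(\<lambda>z. 1) \<in> hardy_orlicz (comp_log \<phi>1)"
  proof -
    have "(\<integral>\<^sup>+ \<zeta>. ennreal (comp_log \<phi>1 (norm (boundary_value (\<lambda>z. 1) \<zeta>))) \<partial>circle_measure) =
        (\<integral>\<^sup>+ \<zeta>. ennreal (comp_log \<phi>1 1) \<partial>circle_measure)"
      using AE_circle_measure_norm
      by (intro nn_integral_cong_AE, eventually_elim)
        (simp add: boundary_value_eqI[where f="\<lambda>z. 1" and l=1])
    also have "\<dots> < \<infinity>" by (simp add: emeasure_circle_measure_UNIV)
    finally show ?thesis using smirnov_one by (simp add: hardy_orlicz_def)
  qed
  from mult[OF this] have g_smirnov: "g \<in> smirnov" by (simp add: hardy_orlicz_def)
  have "(\<lambda>z. g z * f z) \<in> hardy_orlicz (comp_log \<phi>2)" if f: "f \<in> hardy_orlicz (comp_log \<phi>2)" for f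
  proof -
    have f_smirnov: "f \<in> smirnov"
      and f_fin: "(\<integral>\<^sup>+ \<zeta>. ennreal (comp_log \<phi>2 (norm (boundary_value f \<zeta>))) \<partial>circle_measure) < \<infinity>"
      using f by (auto simp: hardy_orlicz_def)
    obtain mf where mf [measurable]: "mf \<in> borel_measurable borel"
      and f_eq: "AE \<zeta> in circle_measure. boundary_value f \<zeta> = mf \<zeta>"
      by (rule boundary_value_measurable[OF f_smirnov]) (rule that)
    have "(\<integral>\<^sup>+ \<zeta>. ennreal (comp_log \<phi>2 (norm (boundary_value f \<zeta>))) \<partial>circle_measure) =
        (\<integral>\<^sup>+ \<zeta>. ennreal (comp_log \<phi>2 (norm (mf \<zeta>))) \<partial>circle_measure)"
      using f_eq by (intro nn_integral_cong_AE, eventually_elim) simp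
    with f_fin have mf_fin: "(\<integral>\<^sup>+ \<zeta>. ennreal (comp_log \<phi>2 (norm (mf \<zeta>))) \<partial>circle_measure) < \<infinity>" by simp
    \<comment> \<open>Exceeding both infima keeps \<sigma> in the domains of both inverses;
      exceeding \<open>\<phi>1 0\<close> makes \<Lambda> nonnegative, as
      \<open>smirnov_with_modulus\<close> requires.\<close>
    define s0 where "s0 = max (max (Inf (range \<phi>1)) (Inf (range \<phi>2))) (\<phi>1 0) + 1"
    have s0: "Inf (range \<phi>1) < s0" "Inf (range \<phi>2) < s0" "\<phi>1 0 < s0" "0 < s0"
      using strongly_convex_nonneg[OF sc1, of 0] by (auto simp: s0_def)
    define \<sigma> where "\<sigma> \<zeta> = max s0 (comp_log \<phi>2 (norm (mf \<zeta>)))" for \<zeta>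
    have \<sigma>: "Inf (range \<phi>1) < \<sigma> \<zeta>" "Inf (range \<phi>2) < \<sigma> \<zeta>" "\<phi>1 0 < \<sigma> \<zeta>" "0 < \<sigma> \<zeta>" for \<zeta>
      using s0 by (auto simp: \<sigma>_def less_max_iff_disj)
    have \<sigma>_measurable [measurable]: "\<sigma> \<in> borel_measurable borel" unfolding \<sigma>_def by measurable
    have \<sigma>_fin: "(\<integral>\<^sup>+ \<zeta>. ennreal (\<sigma> \<zeta>) \<partial>circle_measure) < \<infinity>"
    proof -
      have "(\<integral>\<^sup>+ \<zeta>. ennreal (\<sigma> \<zeta>) \<partial>circle_measure) \<le>
          (\<integral>\<^sup>+ \<zeta>. ennreal s0 + ennreal (comp_log \<phi>2 (norm (mf \<zeta>))) \<partial>circle_measure)"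
      proof (rule nn_integral_mono)
        fix \<zeta>
        show "ennreal (\<sigma> \<zeta>) \<le> ennreal s0 + ennreal (comp_log \<phi>2 (norm (mf \<zeta>)))"
          using s0(4) comp_log_nonneg[OF sc2, of "norm (mf \<zeta>)"]
          by (auto simp: \<sigma>_def simp flip: ennreal_plus intro!: ennreal_leI)
      qed
      also have "\<dots> = ennreal s0 + (\<integral>\<^sup>+ \<zeta>. ennreal (comp_log \<phi>2 (norm (mf \<zeta>))) \<partial>circle_measure)"
        by (subst nn_integral_add) (auto simp: emeasure_circle_measure_UNIV)
      also have "\<dots> < \<infinity>" using mf_fin by simp
      finally show ?thesis .
    qed
    have \<sigma>_int: "integrable circle_measure \<sigma>"
      using \<sigma>_fin \<sigma>(4) by (intro integrableI_bounded) (auto simp: less_imp_le)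
    define \<Lambda> where "\<Lambda> \<zeta> = sc_inverse \<phi>1 (\<sigma> \<zeta>)" for \<zeta>
    have \<Lambda>: "\<phi>1 (\<Lambda> \<zeta>) = \<sigma> \<zeta>" for \<zeta>
      unfolding \<Lambda>_def by (intro strongly_convex_sc_inverse[OF sc1] \<sigma>)
    have \<Lambda>_nonneg: "0 \<le> \<Lambda> \<zeta>" for \<zeta>
      using strongly_convex_mono[OF sc1, of "\<Lambda> \<zeta>" 0] \<sigma>(3)[of \<zeta>] \<Lambda>[of \<zeta>] by linarith
    \<comment> \<open>The inverse is monotone only on its domain; truncating at \<open>s0\<close>
      gives a monotone, hence Borel, function on the whole line, and \<sigma> already contains this
      truncation.\<close>
    have "mono (\<lambda>s. sc_inverse \<phi>1 (max s0 s))"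
      using s0(1) by (intro monoI sc_inverse_mono[OF sc1]) auto
    then have "(\<lambda>s. sc_inverse \<phi>1 (max s0 s)) \<in> borel_measurable borel" by (rule borel_measurable_mono)
    then have \<Lambda>_measurable [measurable]: "\<Lambda> \<in> borel_measurable borel"
      unfolding \<Lambda>_def \<sigma>_def by measurable
    obtain C where C: "0 < C" "\<And>t. t \<le> C + \<phi>1 t"
      by (rule strongly_convex_superlinear[OF sc1]) (rule that)
    \<comment> \<open>Superlinearity bounds \<Lambda> by
      \<open>C + \<phi>1 (\<Lambda> \<zeta>)\<close>, that is by
      \<open>C + \<sigma> \<zeta>\<close>.\<close>
    have \<Lambda>_int: "integrable circle_measure \<Lambda>"
    proof (rule Bochner_Integration.integrable_bound)
      show "integrable circle_measure (\<lambda>\<zeta>. C + \<sigma> \<zeta>)" using \<sigma>_int by simp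
      have "norm (\<Lambda> \<zeta>) \<le> norm (C + \<sigma> \<zeta>)" for \<zeta>
        using C(1) C(2)[of "\<Lambda> \<zeta>"] \<Lambda>[of \<zeta>] \<Lambda>_nonneg[of \<zeta>] by simp
      then show "AE \<zeta> in circle_measure. norm (\<Lambda> \<zeta>) \<le> norm (C + \<sigma> \<zeta>)" by simp
    qed simp
    obtain F where F: "F \<in> smirnov" and F_norm: "AE \<zeta> in circle_measure. norm (boundary_value F \<zeta>) = exp (\<Lambda> \<zeta>)"
      by (rule smirnov_with_modulus[OF \<Lambda>_int \<Lambda>_nonneg]) (rule that)
    have "(\<integral>\<^sup>+ \<zeta>. ennreal (comp_log \<phi>1 (norm (boundary_value F \<zeta>))) \<partial>circle_measure) =
        (\<integral>\<^sup>+ \<zeta>. ennreal (\<sigma> \<zeta>) \<partial>circle_measure)"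
      using F_norm by (intro nn_integral_cong_AE, eventually_elim) (simp add: comp_log_def \<Lambda>)
    then have "F \<in> hardy_orlicz (comp_log \<phi>1)"
      using F \<sigma>_fin by (simp add: hardy_orlicz_def)
    from mult[OF this]
    have gF: "(\<lambda>z. g z * F z) \<in> smirnov"
      and gF_fin: "(\<integral>\<^sup>+ \<zeta>. ennreal (comp_log \<phi>1 (norm (boundary_value (\<lambda>z. g z * F z) \<zeta>))) \<partial>circle_measure) < \<infinity>"
      by (auto simp: hardy_orlicz_def)
    obtain mk where mk [measurable]: "mk \<in> borel_measurable borel"
      and gF_eq: "AE \<zeta> in circle_measure. boundary_value (\<lambda>z. g z * F z) \<zeta> = mk \<zeta>"
      by (rule boundary_value_measurable[OF gF]) (rule that)
    have "(\<integral>\<^sup>+ \<zeta>. ennreal (comp_log \<phi>1 (norm (boundary_value (\<lambda>z. g z * F z) \<zeta>))) \<partial>circle_measure) =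
        (\<integral>\<^sup>+ \<zeta>. ennreal (comp_log \<phi>1 (norm (mk \<zeta>))) \<partial>circle_measure)"
      using gF_eq by (intro nn_integral_cong_AE, eventually_elim) simp
    with gF_fin have mk_fin: "(\<integral>\<^sup>+ \<zeta>. ennreal (comp_log \<phi>1 (norm (mk \<zeta>))) \<partial>circle_measure) < \<infinity>" by simp
    \<comment> \<open>The majorant is written with the Borel representatives so that its integral
      splits into two finite ones.\<close>
    have "AE \<zeta> in circle_measure. ennreal (comp_log \<phi>2 (norm (boundary_value (\<lambda>z. g z * f z) \<zeta>))) \<le>
        ennreal (comp_log \<phi>2 (norm (mf \<zeta>))) + ennreal (comp_log \<phi>1 (norm (mk \<zeta>)))"
      using f_eq gF_eq F_norm smirnov_has_boundary_value[OF g_smirnov]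
        smirnov_has_boundary_value[OF f_smirnov] smirnov_has_boundary_value[OF F]
    proof eventually_elim
      case (elim \<zeta>)
      have 1: "norm (boundary_value (\<lambda>z. g z * f z) \<zeta>) = norm (boundary_value g \<zeta>) * norm (mf \<zeta>)"
        using elim by (simp add: boundary_value_mult norm_mult)
      have 2: "norm (mk \<zeta>) = norm (boundary_value g \<zeta>) * exp (sc_inverse \<phi>1 (\<sigma> \<zeta>))"
        using elim by (metis boundary_value_mult norm_mult \<Lambda>_def)
      have "comp_log \<phi>2 (norm (boundary_value (\<lambda>z. g z * f z) \<zeta>)) \<le>
          comp_log \<phi>2 (norm (mf \<zeta>)) + comp_log \<phi>1 (norm (mk \<zeta>))"
        unfolding 1 2 by (rule comp_log_mult_le[OF assms]) (auto simp: \<sigma>, simp add: \<sigma>_def)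
      then show ?case
        by (simp add: comp_log_nonneg[OF sc1] comp_log_nonneg[OF sc2] ennreal_leI flip: ennreal_plus)
    qed
    then have "(\<integral>\<^sup>+ \<zeta>. ennreal (comp_log \<phi>2 (norm (boundary_value (\<lambda>z. g z * f z) \<zeta>))) \<partial>circle_measure) \<le>
        (\<integral>\<^sup>+ \<zeta>. ennreal (comp_log \<phi>2 (norm (mf \<zeta>))) + ennreal (comp_log \<phi>1 (norm (mk \<zeta>))) \<partial>circle_measure)"
      by (rule nn_integral_mono_AE)
    also have "\<dots> = (\<integral>\<^sup>+ \<zeta>. ennreal (comp_log \<phi>2 (norm (mf \<zeta>))) \<partial>circle_measure) +
        (\<integral>\<^sup>+ \<zeta>. ennreal (comp_log \<phi>1 (norm (mk \<zeta>))) \<partial>circle_measure)"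
      by (rule nn_integral_add) measurable
    also have "\<dots> < \<infinity>" using mf_fin mk_fin by simp
    finally show ?thesis
      using smirnov_mult[OF g_smirnov f_smirnov] by (simp add: hardy_orlicz_def)
  qed
  then show "g \<in> Mult (hardy_orlicz (comp_log \<phi>2))" using holo by (simp add: Mult_def)
qed

end
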